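(* Let $n$ be a positive integer which is not square free and let $k$ be a field with enough $n$-th roots of unity, i.e. containing $n$ different $n$-th roots of unity. The algebra $k^n$ (viewed as a $k$-category with one object) does not admit a universal covering.
   Context: $k^n$ is the product algebra with componentwise operations. A $k$-category is a small category $\mathcal B$ whose morphism sets are $k$-vector spaces with $k$-bilinear composition. It is connected if any two objects are joined by a non-zero walk, i.e. a finite composable sequence $(f_m,\epsilon_m)\cdots(f_1,\epsilon_1)$ of non-zero morphisms with signs $\epsilon_i=\pm1$ (sign $-1$ exchanges source and target). The star $\mathsf{St}_b\mathcal B$ is the direct sum of all morphism spaces with source $b$ and all morphism spaces with target $b$. A covering is a $k$-functor $F:\mathcal C\to\mathcal B$, surjective on objects, inducing an isomorphism $\mathsf{St}_x\mathcal C\to\mathsf{St}_b\mathcal B$ for each object $b$ of $\mathcal B$ and each $x\in F^{-1}(b)$. $\mathsf{Aut}_1F$ is the group of invertible endofunctors $G$ of $\mathcal C$ with $FG=F$. $F$ is a Galois covering if $\mathcal C$ is connected and $\mathsf{Aut}_1F$ acts transitively on some fibre. A morphism of coverings from $F:\mathcal C\to\mathcal B$ to $G:\mathcal D\to\mathcal B$ is a pair $(H,J)$ of $k$-linear functors $H:\mathcal C\to\mathcal D$, $J:\mathcal B\to\mathcal B$ with $J$ an isomorphism that is the identity on objects and $GH=JF$. A universal covering of $\mathcal B$ is a Galois covering $U:\mathcal U\to\mathcal B$ such that for any Galois covering $F:\mathcal C\to\mathcal B$ and any objects $u_0$ of $\mathcal U$, $c_0$ of $\mathcal C$ with $U(u_0)=F(c_0)$,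 there is a unique morphism $(H,1)$ from $U$ to $F$ with $H(u_0)=c_0$. *)

theory Defs
  imports "HOL-Algebra.Module" "HOL-Computational_Algebra.Squarefree" "HOL-Library.FuncSet"
begin

definition linear_maps ::
    "('k, 'r) ring_scheme \<Rightarrow> ('k, 'm) module \<Rightarrow> ('k, 'v) module \<Rightarrow> ('m \<Rightarrow> 'v) set" where
  "linear_maps K M N =
     {f \<in> carrier M \<rightarrow> carrier N.
        (\<forall>u\<in>carrier M. \<forall>v\<in>carrier M. f (u \<oplus>\<^bsub>M\<^esub> v) = f u \<oplus>\<^bsub>N\<^esub> f v) \<and>
        (\<forall>a\<in>carrier K. \<forall>u\<in>carrier M. f (a \<odot>\<^bsub>M\<^esub> u) = a \<odot>\<^bsub>N\<^esub> f u)}"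

definition linear_isos ::
    "('k, 'r) ring_scheme \<Rightarrow> ('k, 'm) module \<Rightarrow> ('k, 'v) module \<Rightarrow> ('m \<Rightarrow> 'v) set" where
  "linear_isos K M N = {f \<in> linear_maps K M N. bij_betw f (carrier M) (carrier N)}"

text \<open>Families of finite support. The record type of modules extends that of rings; the
  multiplicative part of the direct sum is irrelevant and left undefined.\<close>

definition direct_sum :: "'i set \<Rightarrow> ('i \<Rightarrow> ('k, 'm) module) \<Rightarrow> ('k, 'i \<Rightarrow> 'm) module" where
  "direct_sum I M =
     \<lparr>carrier = {f \<in> (\<Pi>\<^sub>E i\<in>I. carrier (M i)). finite {i \<in> I. f i \<noteq> \<zero>\<^bsub>M i\<^esub>}},
      monoid.mult = undefined, one = undefined,
      zero = (\<lambda>i\<in>I. \<zero>\<^bsub>M i\<^esub>),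
      add = (\<lambda>f g. \<lambda>i\<in>I. f i \<oplus>\<^bsub>M i\<^esub> g i),
      smult = (\<lambda>a f. \<lambda>i\<in>I. a \<odot>\<^bsub>M i\<^esub> f i)\<rparr>"

text \<open>\<open>Mor C x y\<close> is the space of morphisms from \<open>x\<close> to \<open>y\<close> (only its structure as a module is
  used), and \<open>Comp C x y z g f\<close> is the composite of \<open>f : x \<rightarrow> y\<close> followed by \<open>g : y \<rightarrow> z\<close>.
  Distinct morphism spaces may share elements of the type \<open>'m\<close>; a morphism is therefore always
  considered together with its source and target.\<close>

record ('k, 'o, 'm) kcategory =
  Obj :: "'o set"
  Mor :: "'o \<Rightarrow> 'o \<Rightarrow> ('k, 'm) module"
  Comp :: "'o \<Rightarrow> 'o \<Rightarrow> 'o \<Rightarrow> 'm \<Rightarrow> 'm \<Rightarrow> 'm"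
  Ident :: "'o \<Rightarrow> 'm"

locale k_category = field K for K (structure) +
  fixes C :: "('a, 'o, 'm) kcategory"
  assumes Mor_module: "\<lbrakk>x \<in> Obj C; y \<in> Obj C\<rbrakk> \<Longrightarrow> module K (Mor C x y)"
    and Ident_closed: "x \<in> Obj C \<Longrightarrow> Ident C x \<in> carrier (Mor C x x)"
    and Comp_linear_right:
      "\<lbrakk>x \<in> Obj C; y \<in> Obj C; z \<in> Obj C; g \<in> carrier (Mor C y z)\<rbrakk> \<Longrightarrow>
         (\<lambda>f. Comp C x y z g f) \<in> linear_maps K (Mor C x y) (Mor C x z)"
    and Comp_linear_left:
      "\<lbrakk>x \<in> Obj C; y \<in> Obj C; z \<in> Obj C; f \<in> carrier (Mor C x y)\<rbrakk> \<Longrightarrow>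
         (\<lambda>g. Comp C x y z g f) \<in> linear_maps K (Mor C y z) (Mor C x z)"
    and Comp_Ident_left:
      "\<lbrakk>x \<in> Obj C; y \<in> Obj C; f \<in> carrier (Mor C x y)\<rbrakk> \<Longrightarrow> Comp C x y y (Ident C y) f = f"
    and Comp_Ident_right:
      "\<lbrakk>x \<in> Obj C; y \<in> Obj C; f \<in> carrier (Mor C x y)\<rbrakk> \<Longrightarrow> Comp C x x y f (Ident C x) = f"
    and Comp_assoc:
      "\<lbrakk>w \<in> Obj C; x \<in> Obj C; y \<in> Obj C; z \<in> Obj C;
        f \<in> carrier (Mor C w x); g \<in> carrier (Mor C x y); h \<in> carrier (Mor C y z)\<rbrakk> \<Longrightarrow>
         Comp C w x z (Comp C x y z h g) f = Comp C w y z h (Comp C w x y g f)"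

text \<open>A walk is listed in the order in which it is traversed; a step \<open>(s, t, f, \<epsilon>)\<close> is a morphism
  \<open>f : s \<rightarrow> t\<close> with a sign, \<open>\<epsilon> = True\<close> standing for \<open>+1\<close>.\<close>

fun nonzero_walk ::
    "('k, 'o, 'm) kcategory \<Rightarrow> 'o \<Rightarrow> ('o \<times> 'o \<times> 'm \<times> bool) list \<Rightarrow> 'o \<Rightarrow> bool" where
  "nonzero_walk C x [] y \<longleftrightarrow> x = y"
| "nonzero_walk C x ((s, t, f, \<epsilon>) # w) y \<longleftrightarrow>
     s \<in> Obj C \<and> t \<in> Obj C \<and> f \<in> carrier (Mor C s t) \<and> f \<noteq> \<zero>\<^bsub>Mor C s t\<^esub> \<and>
     x = (if \<epsilon> then s else t) \<and> nonzero_walk C (if \<epsilon> then t else s) w y"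

definition connected_kcategory :: "('k, 'o, 'm) kcategory \<Rightarrow> bool" where
  "connected_kcategory C \<longleftrightarrow>
     (\<forall>x\<in>Obj C. \<forall>y\<in>Obj C. \<exists>w. w \<noteq> [] \<and> nonzero_walk C x w y)"

record ('o, 'm, 'p, 'v) kfunctor =
  FObj :: "'o \<Rightarrow> 'p"
  FMor :: "'o \<Rightarrow> 'o \<Rightarrow> 'm \<Rightarrow> 'v"

definition k_functor ::
    "('k, 'r) ring_scheme \<Rightarrow> ('k, 'o, 'm) kcategory \<Rightarrow> ('k, 'p, 'v) kcategory \<Rightarrow>
     ('o, 'm, 'p, 'v) kfunctor \<Rightarrow> bool" where
  "k_functor K C D F \<longleftrightarrow>
     k_category K C \<and> k_category K D \<and>
     FObj F \<in> Obj C \<rightarrow> Obj D \<and>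
     (\<forall>x\<in>Obj C. \<forall>y\<in>Obj C.
        FMor F x y \<in> linear_maps K (Mor C x y) (Mor D (FObj F x) (FObj F y))) \<and>
     (\<forall>x\<in>Obj C. FMor F x x (Ident C x) = Ident D (FObj F x)) \<and>
     (\<forall>x\<in>Obj C. \<forall>y\<in>Obj C. \<forall>z\<in>Obj C. \<forall>f\<in>carrier (Mor C x y). \<forall>g\<in>carrier (Mor C y z).
        FMor F x z (Comp C x y z g f) =
          Comp D (FObj F x) (FObj F y) (FObj F z) (FMor F y z g) (FMor F x y f))"

text \<open>Equality of functors with source \<open>C\<close>: the HOL functions in the record are unconstrained
  outside the objects and morphisms of \<open>C\<close>.\<close>

definition functor_eq ::
    "('k, 'o, 'm) kcategory \<Rightarrow> ('o, 'm, 'p, 'v) kfunctor \<Rightarrow> ('o, 'm, 'p, 'v) kfunctor \<Rightarrow> bool" where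
  "functor_eq C F G \<longleftrightarrow>
     (\<forall>x\<in>Obj C. FObj F x = FObj G x) \<and>
     (\<forall>x\<in>Obj C. \<forall>y\<in>Obj C. \<forall>f\<in>carrier (Mor C x y). FMor F x y f = FMor G x y f)"

definition id_functor :: "('o, 'm, 'o, 'm) kfunctor" where
  "id_functor = \<lparr>FObj = (\<lambda>x. x), FMor = (\<lambda>x y f. f)\<rparr>"

definition comp_functor ::
    "('p, 'v, 'q, 'w) kfunctor \<Rightarrow> ('o, 'm, 'p, 'v) kfunctor \<Rightarrow> ('o, 'm, 'q, 'w) kfunctor" where
  "comp_functor G F =
     \<lparr>FObj = (\<lambda>x. FObj G (FObj F x)),
      FMor = (\<lambda>x y f. FMor G (FObj F x) (FObj F y) (FMor F x y f))\<rparr>"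

definition invertible_functor ::
    "('k, 'r) ring_scheme \<Rightarrow> ('k, 'o, 'm) kcategory \<Rightarrow> ('k, 'p, 'v) kcategory \<Rightarrow>
     ('o, 'm, 'p, 'v) kfunctor \<Rightarrow> bool" where
  "invertible_functor K C D F \<longleftrightarrow>
     k_functor K C D F \<and>
     (\<exists>G. k_functor K D C G \<and>
          functor_eq C (comp_functor G F) id_functor \<and>
          functor_eq D (comp_functor F G) id_functor)"

text \<open>The summands of the star at \<open>b\<close> are indexed by two copies of the objects: \<open>Inl y\<close> for the
  morphisms \<open>b \<rightarrow> y\<close> and \<open>Inr y\<close> for the morphisms \<open>y \<rightarrow> b\<close>. Endomorphisms of \<open>b\<close> thus occur
  twice.\<close>

fun star_space :: "('k, 'o, 'm) kcategory \<Rightarrow> 'o \<Rightarrow> 'o + 'o \<Rightarrow> ('k, 'm) module" where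
  "star_space C b (Inl y) = Mor C b y"
| "star_space C b (Inr y) = Mor C y b"

definition star :: "('k, 'o, 'm) kcategory \<Rightarrow> 'o \<Rightarrow> ('k, 'o + 'o \<Rightarrow> 'm) module" where
  "star C b = direct_sum (Obj C <+> Obj C) (star_space C b)"

fun star_functor :: "('o, 'm, 'p, 'v) kfunctor \<Rightarrow> 'o \<Rightarrow> 'o + 'o \<Rightarrow> 'm \<Rightarrow> 'v" where
  "star_functor F x (Inl y) f = FMor F x y f"
| "star_functor F x (Inr y) f = FMor F y x f"

text \<open>The map from the star at \<open>x\<close> to the star at \<open>F x\<close> induced by \<open>F\<close>. The sum is restricted to
  the support of \<open>s\<close>, as \<open>finsum\<close> is only meaningful over finite sets.\<close>

definition star_map ::
    "('k, 'o, 'm) kcategory \<Rightarrow> ('k, 'p, 'v) kcategory \<Rightarrow> ('o, 'm, 'p, 'v) kfunctor \<Rightarrow> 'o \<Rightarrow>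
     ('o + 'o \<Rightarrow> 'm) \<Rightarrow> ('p + 'p \<Rightarrow> 'v)" where
  "star_map C B F x s =
     (\<lambda>j\<in>Obj B <+> Obj B.
        finsum (star_space B (FObj F x) j) (\<lambda>i. star_functor F x i (s i))
          {i \<in> Obj C <+> Obj C.
             map_sum (FObj F) (FObj F) i = j \<and> s i \<noteq> \<zero>\<^bsub>star_space C x i\<^esub>})"

definition covering ::
    "('k, 'r) ring_scheme \<Rightarrow> ('k, 'o, 'm) kcategory \<Rightarrow> ('k, 'p, 'v) kcategory \<Rightarrow>
     ('o, 'm, 'p, 'v) kfunctor \<Rightarrow> bool" where
  "covering K C B F \<longleftrightarrow>
     k_functor K C B F \<and>
     FObj F ` Obj C = Obj B \<and>
     (\<forall>b\<in>Obj B. \<forall>x\<in>Obj C. FObj F x = b \<longrightarrow>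
        star_map C B F x \<in> linear_isos K (star C x) (star B b))"

definition Aut1 ::
    "('k, 'r) ring_scheme \<Rightarrow> ('k, 'o, 'm) kcategory \<Rightarrow> ('o, 'm, 'p, 'v) kfunctor \<Rightarrow>
     ('o, 'm, 'o, 'm) kfunctor set" where
  "Aut1 K C F = {G. invertible_functor K C C G \<and> functor_eq C (comp_functor F G) F}"

definition galois_covering ::
    "('k, 'r) ring_scheme \<Rightarrow> ('k, 'o, 'm) kcategory \<Rightarrow> ('k, 'p, 'v) kcategory \<Rightarrow>
     ('o, 'm, 'p, 'v) kfunctor \<Rightarrow> bool" where
  "galois_covering K C B F \<longleftrightarrow>
     covering K C B F \<and> connected_kcategory C \<and>
     (\<exists>b\<in>Obj B. \<forall>x\<in>Obj C. \<forall>y\<in>Obj C. FObj F x = b \<and> FObj F y = b \<longrightarrow>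
        (\<exists>G\<in>Aut1 K C F. FObj G x = y))"

definition covering_morphism ::
    "('k, 'r) ring_scheme \<Rightarrow> ('k, 'p, 'v) kcategory \<Rightarrow>
     ('k, 'o, 'm) kcategory \<Rightarrow> ('o, 'm, 'p, 'v) kfunctor \<Rightarrow>
     ('k, 'q, 'w) kcategory \<Rightarrow> ('q, 'w, 'p, 'v) kfunctor \<Rightarrow>
     ('o, 'm, 'q, 'w) kfunctor \<Rightarrow> ('p, 'v, 'p, 'v) kfunctor \<Rightarrow> bool" where
  "covering_morphism K B C F D G H J \<longleftrightarrow>
     covering K C B F \<and> covering K D B G \<and>
     k_functor K C D H \<and>
     invertible_functor K B B J \<and> (\<forall>b\<in>Obj B. FObj J b = b) \<and>
     functor_eq C (comp_functor G H) (comp_functor J F)"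

text \<open>HOL cannot quantify over types inside a formula, so the universe through which the Galois
  coverings \<open>F : C \<rightarrow> B\<close> of the universal property range is a parameter: objects of \<open>C\<close> are taken
  from \<open>'c\<close> and morphisms of \<open>C\<close> from \<open>'d\<close>. The types of \<open>U\<close> and of \<open>B\<close> are not tied to it.\<close>

definition universal_covering ::
    "('c \<times> 'd) itself \<Rightarrow> ('k, 'r) ring_scheme \<Rightarrow>
     ('k, 'u, 'x) kcategory \<Rightarrow> ('k, 'p, 'v) kcategory \<Rightarrow> ('u, 'x, 'p, 'v) kfunctor \<Rightarrow> bool" where
  "universal_covering T K \<U> B U \<longleftrightarrow>
     galois_covering K \<U> B U \<and>
     (\<forall>(C :: ('k, 'c, 'd) kcategory) F. galois_covering K C B F \<longrightarrow>
        (\<forall>u\<^sub>0\<in>Obj \<U>. \<forall>c\<^sub>0\<in>Obj C. FObj U u\<^sub>0 = FObj F c\<^sub>0 \<longrightarrow>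
           (\<exists>H. covering_morphism K B \<U> U C F H id_functor \<and> FObj H u\<^sub>0 = c\<^sub>0 \<and>
                (\<forall>H'. covering_morphism K B \<U> U C F H' id_functor \<and> FObj H' u\<^sub>0 = c\<^sub>0 \<longrightarrow>
                      functor_eq \<U> H' H))))"

definition power_algebra :: "('k, 'r) ring_scheme \<Rightarrow> nat \<Rightarrow> ('k, nat \<Rightarrow> 'k) module" where
  "power_algebra K n =
     \<lparr>carrier = (\<Pi>\<^sub>E i\<in>{..<n}. carrier K),
      monoid.mult = (\<lambda>f g. \<lambda>i\<in>{..<n}. f i \<otimes>\<^bsub>K\<^esub> g i),
      one = (\<lambda>i\<in>{..<n}. \<one>\<^bsub>K\<^esub>),
      zero = (\<lambda>i\<in>{..<n}. \<zero>\<^bsub>K\<^esub>),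
      add = (\<lambda>f g. \<lambda>i\<in>{..<n}. f i \<oplus>\<^bsub>K\<^esub> g i),
      smult = (\<lambda>a f. \<lambda>i\<in>{..<n}. a \<otimes>\<^bsub>K\<^esub> f i)\<rparr>"

definition one_object_category :: "('k, 'm) module \<Rightarrow> ('k, unit, 'm) kcategory" where
  "one_object_category A =
     \<lparr>Obj = {()}, Mor = (\<lambda>_ _. A), Comp = (\<lambda>_ _ _ g f. g \<otimes>\<^bsub>A\<^esub> f), Ident = (\<lambda>_. \<one>\<^bsub>A\<^esub>)\<rparr>"

end

theory Submission
  imports Defs "HOL-Algebra.Polynomial_Divisibility" "HOL-Algebra.Elementary_Groups"
begin

text \<open>A grading of an algebra \<open>A\<close> by a finite group \<open>G\<close> with all components non-zero yields a Galois
  covering of \<open>A\<close>, its smash product with \<open>G\<close>: the objects are the elements of \<open>G\<close>, and the morphisms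
  from \<open>g\<close> to \<open>h\<close> are the homogeneous elements of degree \<open>g\<inverse>h\<close>. Over a field with \<open>n\<close> different \<open>n\<close>-th
  roots of unity, \<open>k\<^sup>n\<close> is the group algebra of every abelian group of order \<open>n\<close>.
  For \<open>n = d m\<close>, let \<open>\<mu>\<^sub>d\<close> be the group of \<open>d\<close>-th roots of unity. The product \<open>\<mu>\<^sub>d \<times> \<mu>\<^sub>m\<close> grades \<open>k\<^sup>n\<close>
  with the line spanned by \<open>i \<mapsto> \<xi> ^ (i mod d) * \<eta> ^ (i div d)\<close> as component of degree \<open>(\<xi>, \<eta>)\<close>.

  A universal covering \<open>U\<close> has a morphism to each of these coverings, so it maps every morphism to an
  element that is homogeneous for all of these gradings at once (\<open>universal_covering_factors\<close>).
  On the other hand, the images of the morphisms with a fixed source span \<open>k\<^sup>n\<close>, because \<open>U\<close> is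
  bijective on stars (\<open>covering_star_spans\<close>). When \<open>n\<close> is not squarefree, two of the gradings have too
  few common homogeneous elements for this. Write \<open>n = p m\<close> with \<open>1 < p\<close> and \<open>p dvd m\<close>, and let \<open>v\<close> be
  homogeneous both for \<open>\<mu>\<^sub>n\<close> (the case \<open>d = 1\<close>) and for \<open>\<mu>\<^sub>p \<times> \<mu>\<^sub>m\<close>. The exponent of the second group
  divides \<open>m\<close>, so \<open>v ^ m\<close> is a constant function. By the first grading \<open>v i = a \<zeta> ^ i\<close>, and comparing
  \<open>v ^ m\<close> at \<open>0\<close> and \<open>1\<close> gives \<open>a = 0\<close> or \<open>\<zeta> ^ m = 1\<close>; in both cases \<open>v 0 = v m\<close>. Such elements do not
  span \<open>k\<^sup>n\<close>, as \<open>0 < m < n\<close>.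

  That the lines form a grading is Fourier inversion for the perfect pairing of \<open>\<mu>\<^sub>d \<times> \<mu>\<^sub>m\<close> with
  \<open>\<int>/d \<times> \<int>/m\<close> (\<open>expansion_exists\<close>, \<open>expansion_unique\<close>). It needs that \<open>\<mu>\<^sub>d\<close> has order \<open>d\<close> for each
  divisor \<open>d\<close> of \<open>n\<close>, and that \<open>n\<close> is non-zero in the field; both follow from counting roots of
  polynomials.\<close>

section \<open>Roots of unity and character sums\<close>

context field
begin

lemma card_roots_le:
  assumes "set p \<subseteq> carrier R" "p \<noteq> []" "hd p \<noteq> \<zero>"
  shows "finite {x \<in> carrier R. eval p x = \<zero>} \<and> card {x \<in> carrier R. eval p x = \<zero>} < length p"
proof -
  have p: "p \<in> carrier (poly_ring R)"
    using assms unfolding sym[OF univ_poly_carrier] polynomial_def by simp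
  have "{x \<in> carrier R. eval p x = \<zero>} = set_mset (roots p)"
    using roots_mem_iff_is_root[OF p] assms(2) by (auto simp: is_root_def)
  moreover have "card (set_mset (roots p)) \<le> size (roots p)"
    by (metis size_mset_set size_mset_mono mset_set_set_mset_msubset)
  moreover have "length p > 0" using assms(2) by simp
  ultimately show ?thesis
    using size_roots_le_degree[OF p] assms(2) by (cases p) (auto simp: less_Suc_eq_le)
qed

lemma card_roots_of_unity_le:
  assumes "0 < d"
  shows "finite {x \<in> carrier R. x [^] d = \<one>}" and "card {x \<in> carrier R. x [^] d = \<one>} \<le> d"
proof -
  let ?p = "monom \<one> (d - 1) @ [\<ominus> \<one>]"
  have p: "set ?p \<subseteq> carrier R" "?p \<noteq> []" "hd ?p \<noteq> \<zero>" "length ?p = Suc d"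
    using assms by (auto simp: monom_def)
  have "eval ?p x = x [^] d \<oplus> \<ominus> \<one>" if "x \<in> carrier R" for x
  proof -
    have "eval ?p x = x [^] (d - 1) \<otimes> x [^] (1 :: nat) \<oplus> \<ominus> \<one>"
      using that by (subst eval_append) (auto simp: eval_monom monom_in_carrier)
    also have "x [^] (d - 1) \<otimes> x [^] (1 :: nat) = x [^] d"
      using that assms by (subst nat_pow_mult) auto
    finally show ?thesis .
  qed
  moreover have "y = \<one> \<longleftrightarrow> y \<oplus> \<ominus> \<one> = \<zero>" if "y \<in> carrier R" for y
    using that by (metis add.inv_closed minus_equality minus_minus one_closed r_neg)
  ultimately have "{x \<in> carrier R. x [^] d = \<one>} = {x \<in> carrier R. eval ?p x = \<zero>}"
    by auto
  then show "finite {x \<in> carrier R. x [^] d = \<one>}" "card {x \<in> carrier R. x [^] d = \<one>} \<le> d"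
    using card_roots_le[OF p(1-3)] p(4) by auto
qed

lemma eval_all_ones:
  assumes "x \<in> carrier R"
  shows "eval (replicate n \<one>) x \<otimes> (x \<oplus> \<ominus> \<one>) = x [^] n \<oplus> \<ominus> \<one>"
    and "eval (replicate n \<one>) \<one> = add_pow R n \<one>"
proof (induction n)
  case 0
  {
    case 1
    then show ?case using assms by (simp add: r_neg)
  next
    case 2
    then show ?case by simp
  }
next
  case (Suc n)
  {
    case 1
    have c: "eval (replicate n \<one>) x \<in> carrier R" "x [^] n \<in> carrier R"
      using assms by (auto intro!: eval_in_carrier)
    have "eval (replicate (Suc n) \<one>) x \<otimes> (x \<oplus> \<ominus> \<one>)
        = x [^] n \<otimes> (x \<oplus> \<ominus> \<one>) \<oplus> eval (replicate n \<one>) x \<otimes> (x \<oplus> \<ominus> \<one>)"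
      using assms c by (simp add: l_distr)
    also have "\<dots> = x [^] n \<otimes> (x \<oplus> \<ominus> \<one>) \<oplus> (x [^] n \<oplus> \<ominus> \<one>)"
      using Suc by simp
    also have "\<dots> = x [^] n \<otimes> x \<oplus> \<ominus> \<one>"
      using assms c by algebra
    finally show ?case by simp
  next
    case 2
    then show ?case using Suc by (simp add: a_comm)
  }
qed

text \<open>The polynomial \<open>1 + x + \<dots> + x ^ (n - 1)\<close> vanishes at all \<open>n\<close>-th roots of unity except \<open>1\<close>, where
  its value is \<open>n\<close>. If that were zero too, the polynomial would have \<open>n\<close> roots, more than its degree.\<close>

lemma of_nat_card_roots_of_unity_nonzero:
  assumes "0 < n" "card {x \<in> carrier R. x [^] n = \<one>} = n"
  shows "add_pow R n \<one> \<noteq> \<zero>"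
proof
  assume n0: "add_pow R n \<one> = \<zero>"
  let ?p = "replicate n \<one>"
  have p: "set ?p \<subseteq> carrier R" "?p \<noteq> []" "hd ?p \<noteq> \<zero>"
    using assms(1) by auto
  have "{x \<in> carrier R. x [^] n = \<one>} \<subseteq> {x \<in> carrier R. eval ?p x = \<zero>}"
  proof safe
    fix x assume x: "x \<in> carrier R" "x [^] n = \<one>"
    have "eval ?p x \<otimes> (x \<oplus> \<ominus> \<one>) = \<zero>"
      using eval_all_ones(1)[OF x(1)] x(2) by (simp add: r_neg)
    then have "eval ?p x = \<zero> \<or> x \<oplus> \<ominus> \<one> = \<zero>"
      using x p by (subst (asm) integral_iff) (auto intro!: eval_in_carrier)
    moreover have "x = \<one>" if "x \<oplus> \<ominus> \<one> = \<zero>"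
      using that x(1) by (metis add.inv_closed minus_equality minus_minus one_closed)
    ultimately show "eval ?p x = \<zero>"
      using eval_all_ones(2)[OF x(1), of n] n0 by auto
  qed
  from card_mono[OF conjunct1[OF card_roots_le[OF p]] this] show False
    using card_roots_le[OF p] assms(2) by simp
qed

text \<open>The power map \<open>x \<mapsto> x ^ m\<close> sends the \<open>d m\<close>-th roots of unity to the \<open>d\<close>-th ones, and its
  non-empty fibres are cosets of the group of \<open>m\<close>-th roots of unity, hence have at most \<open>m\<close> elements. So at least \<open>d\<close> values
  are needed.\<close>

lemma card_roots_of_unity_factor:
  assumes "0 < d" "0 < m" "card {x \<in> carrier R. x [^] (d * m) = \<one>} = d * m"
  shows "card {x \<in> carrier R. x [^] d = \<one>} = d"
proof -
  let ?U = "\<lambda>k :: nat. {x \<in> carrier R. x [^] k = \<one>}"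
  have fin: "finite (?U d)" "finite (?U m)" "finite (?U (d * m))"
    using card_roots_of_unity_le assms by auto
  have sub: "(\<lambda>x. x [^] m) ` ?U (d * m) \<subseteq> ?U d"
    by (auto simp: nat_pow_pow mult.commute)
  have fibre: "card {x \<in> ?U (d * m). x [^] m = y} \<le> m" for y
  proof (cases "\<exists>z \<in> ?U (d * m). z [^] m = y")
    case True
    then obtain z where z: "z \<in> carrier R" "z [^] (d * m) = \<one>" "z [^] m = y"
      by auto
    have u: "z \<in> Units R"
    proof -
      have "z \<noteq> \<zero>" using z(2) assms by (metis nat_pow_zero nat_0_less_mult_iff zero_not_one not_gr_zero)
      then show ?thesis using z(1) by (simp add: field_Units)
    qed
    have "{x \<in> ?U (d * m). x [^] m = y} \<subseteq> (\<lambda>w. z \<otimes> w) ` ?U m"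
    proof
      fix x assume x: "x \<in> {x \<in> ?U (d * m). x [^] m = y}"
      have "(inv z \<otimes> x) [^] m = inv z [^] m \<otimes> z [^] m"
        using x z u by (simp add: nat_pow_distrib)
      also have "\<dots> = \<one>"
        using u z by (subst nat_pow_distrib[symmetric]) auto
      finally have "inv z \<otimes> x \<in> ?U m" using x u by simp
      moreover have "x = z \<otimes> (inv z \<otimes> x)"
        using x u z by (subst m_assoc[symmetric]) auto
      ultimately show "x \<in> (\<lambda>w. z \<otimes> w) ` ?U m" by blast
    qed
    then have "card {x \<in> ?U (d * m). x [^] m = y} \<le> card (?U m)"
      using fin(2) by (meson card_image_le card_mono finite_imageI le_trans)
    then show ?thesis using card_roots_of_unity_le(2)[OF assms(2)] by simp
  next
    case False
    then have e: "{x \<in> ?U (d * m). x [^] m = y} = {}" by blast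
    show ?thesis unfolding e by simp
  qed
  have "?U (d * m) = (\<Union>y \<in> ?U d. {x \<in> ?U (d * m). x [^] m = y})"
    using sub by auto
  then have "d * m = card (\<Union>y \<in> ?U d. {x \<in> ?U (d * m). x [^] m = y})"
    using assms(3) by metis
  also have "\<dots> \<le> (\<Sum>y \<in> ?U d. card {x \<in> ?U (d * m). x [^] m = y})"
    using fin by (intro card_UN_le)
  also have "\<dots> \<le> card (?U d) * m"
    using sum_bounded_above[of "?U d" _ m] fibre by simp
  finally have "d \<le> card (?U d)" using assms(2) by simp
  then show ?thesis using card_roots_of_unity_le(2)[OF assms(1)] by simp
qed

text \<open>Translation by \<open>h\<close> permutes the summands and multiplies the sum by \<open>\<chi> h\<close>.\<close>

lemma finsum_nontrivial_character:
  assumes "group H" "finite (carrier H)"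
    and ch: "\<And>x. x \<in> carrier H \<Longrightarrow> \<chi> x \<in> carrier R"
      "\<And>x y. x \<in> carrier H \<Longrightarrow> y \<in> carrier H \<Longrightarrow> \<chi> (x \<otimes>\<^bsub>H\<^esub> y) = \<chi> x \<otimes> \<chi> y"
    and h: "h \<in> carrier H" "\<chi> h \<noteq> \<one>"
  shows "(\<Oplus>x\<in>carrier H. \<chi> x) = \<zero>"
proof -
  interpret H: group H by fact
  let ?S = "\<Oplus>x\<in>carrier H. \<chi> x"
  have S: "?S \<in> carrier R" using ch by (intro finsum_closed) auto
  have "\<chi> h \<otimes> ?S = (\<Oplus>x\<in>carrier H. \<chi> h \<otimes> \<chi> x)"
    using ch h assms(2) by (intro finsum_rdistr) auto
  also have "\<dots> = (\<Oplus>x\<in>carrier H. \<chi> (h \<otimes>\<^bsub>H\<^esub> x))"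
    using ch h by (intro finsum_cong') auto
  also have "\<dots> = (\<Oplus>x\<in>(\<lambda>x. h \<otimes>\<^bsub>H\<^esub> x) ` carrier H. \<chi> x)"
    using ch h by (intro finsum_reindex[symmetric]) (auto simp: H.inj_on_cmult)
  also have "(\<lambda>x. h \<otimes>\<^bsub>H\<^esub> x) ` carrier H = carrier H"
    using H.surj_const_mult[OF h(1)] .
  finally have "\<chi> h \<otimes> ?S = ?S" .
  then show ?thesis
    using S ch(1)[OF h(1)] h(2) by (metis l_one m_rcancel one_closed)
qed

lemma finsum_swap:
  assumes "finite I" "finite J" "\<And>i j. i \<in> I \<Longrightarrow> j \<in> J \<Longrightarrow> f i j \<in> carrier R"
  shows "(\<Oplus>i\<in>I. \<Oplus>j\<in>J. f i j) = (\<Oplus>j\<in>J. \<Oplus>i\<in>I. f i j)"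
  using assms(1,3)
proof (induction I rule: finite_induct)
  case (insert a I)
  have c: "f i j \<in> carrier R" if "i \<in> insert a I" "j \<in> J" for i j
    using insert.prems that by blast
  have "(\<Oplus>j\<in>J. \<Oplus>i\<in>insert a I. f i j) = (\<Oplus>j\<in>J. f a j \<oplus> (\<Oplus>i\<in>I. f i j))"
    using insert.hyps c by (intro finsum_cong') (auto intro!: finsum_insert finsum_closed)
  also have "\<dots> = (\<Oplus>j\<in>J. f a j) \<oplus> (\<Oplus>j\<in>J. \<Oplus>i\<in>I. f i j)"
    using c by (intro finsum_addf) (auto intro!: finsum_closed)
  also have "\<dots> = (\<Oplus>i\<in>insert a I. \<Oplus>j\<in>J. f i j)"
    using insert.hyps insert.IH c by (subst finsum_insert) (auto intro!: finsum_closed)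
  finally show ?case by simp
qed simp

lemma finsum_delta:
  assumes "finite A" "a \<in> A" "\<And>x. x \<in> A \<Longrightarrow> f x \<in> carrier R" "b \<in> carrier R"
  shows "(\<Oplus>x\<in>A. f x \<otimes> (if x = a then b else \<zero>)) = f a \<otimes> b"
proof -
  have "(\<Oplus>x\<in>A. f x \<otimes> (if x = a then b else \<zero>)) = (\<Oplus>x\<in>A. if a = x then f x \<otimes> b else \<zero>)"
    using assms by (intro finsum_cong') auto
  also have "\<dots> = f a \<otimes> b"
    using assms by (intro finsum_singleton) auto
  finally show ?thesis .
qed

end

section \<open>Fourier expansion along a perfect pairing\<close>

text \<open>The pairing identifies each of the two groups with the characters of the other. Non-degeneracy on
  both sides gives both orthogonality relations, so the expansion in characters can be inverted by an
  explicit formula; dividing by the common order is the reason why it has to be non-zero in the field.\<close>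

locale perfect_pairing = field R + G: group G + Q: group Q
  for R (structure) and G :: "('g, 'i) monoid_scheme" and Q :: "('x, 'j) monoid_scheme" +
  fixes \<beta> :: "'g \<Rightarrow> 'x \<Rightarrow> 'a"
  assumes finite_left: "finite (carrier G)" and finite_right: "finite (carrier Q)"
    and same_order: "order G = order Q"
    and order_nonzero: "add_pow R (order G) \<one> \<noteq> \<zero>"
    and pair_closed: "\<lbrakk>g \<in> carrier G; x \<in> carrier Q\<rbrakk> \<Longrightarrow> \<beta> g x \<in> carrier R - {\<zero>}"
    and pair_mult_left: "\<lbrakk>g \<in> carrier G; h \<in> carrier G; x \<in> carrier Q\<rbrakk> \<Longrightarrow>
          \<beta> (g \<otimes>\<^bsub>G\<^esub> h) x = \<beta> g x \<otimes> \<beta> h x"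
    and pair_mult_right: "\<lbrakk>g \<in> carrier G; x \<in> carrier Q; y \<in> carrier Q\<rbrakk> \<Longrightarrow>
          \<beta> g (x \<otimes>\<^bsub>Q\<^esub> y) = \<beta> g x \<otimes> \<beta> g y"
    and nondeg_left: "\<lbrakk>g \<in> carrier G; g \<noteq> \<one>\<^bsub>G\<^esub>\<rbrakk> \<Longrightarrow> \<exists>x\<in>carrier Q. \<beta> g x \<noteq> \<one>"
    and nondeg_right: "\<lbrakk>x \<in> carrier Q; x \<noteq> \<one>\<^bsub>Q\<^esub>\<rbrakk> \<Longrightarrow> \<exists>g\<in>carrier G. \<beta> g x \<noteq> \<one>"
begin

lemma pair_in: "\<lbrakk>g \<in> carrier G; x \<in> carrier Q\<rbrakk> \<Longrightarrow> \<beta> g x \<in> carrier R"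
  using pair_closed by blast

lemma pair_one:
  shows "x \<in> carrier Q \<Longrightarrow> \<beta> \<one>\<^bsub>G\<^esub> x = \<one>" and "g \<in> carrier G \<Longrightarrow> \<beta> g \<one>\<^bsub>Q\<^esub> = \<one>"
proof -
  have idem: "a = \<one>" if "a \<in> carrier R - {\<zero>}" "a \<otimes> a = a" for a
    using that by (metis DiffE insertI1 m_lcancel one_closed r_one)
  show "x \<in> carrier Q \<Longrightarrow> \<beta> \<one>\<^bsub>G\<^esub> x = \<one>"
    using pair_mult_left[of "\<one>\<^bsub>G\<^esub>" "\<one>\<^bsub>G\<^esub>" x] by (intro idem pair_closed) auto
  show "g \<in> carrier G \<Longrightarrow> \<beta> g \<one>\<^bsub>Q\<^esub> = \<one>"
    using pair_mult_right[of g "\<one>\<^bsub>Q\<^esub>" "\<one>\<^bsub>Q\<^esub>"] by (intro idem pair_closed) auto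
qed

lemma sum_over_right:
  assumes "g \<in> carrier G"
  shows "(\<Oplus>x\<in>carrier Q. \<beta> g x) = (if g = \<one>\<^bsub>G\<^esub> then add_pow R (order G) \<one> else \<zero>)"
proof (cases "g = \<one>\<^bsub>G\<^esub>")
  case True
  have "(\<Oplus>x\<in>carrier Q. \<beta> g x) = (\<Oplus>x\<in>carrier Q. \<one>)"
    using True by (intro finsum_cong') (auto simp: pair_one)
  then show ?thesis using True same_order by (simp add: add.finprod_const order_def)
next
  case False
  then obtain x where "x \<in> carrier Q" "\<beta> g x \<noteq> \<one>" using nondeg_left assms by blast
  then show ?thesis
    using False assms by (simp, intro finsum_nontrivial_character[OF Q.is_group finite_right])
      (auto simp: pair_in pair_mult_right)
qed

lemma sum_over_left:
  assumes "x \<in> carrier Q"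
  shows "(\<Oplus>g\<in>carrier G. \<beta> g x) = (if x = \<one>\<^bsub>Q\<^esub> then add_pow R (order G) \<one> else \<zero>)"
proof (cases "x = \<one>\<^bsub>Q\<^esub>")
  case True
  have "(\<Oplus>g\<in>carrier G. \<beta> g x) = (\<Oplus>g\<in>carrier G. \<one>)"
    using True by (intro finsum_cong') (auto simp: pair_one)
  then show ?thesis using True by (simp add: add.finprod_const order_def)
next
  case False
  then obtain g where "g \<in> carrier G" "\<beta> g x \<noteq> \<one>" using nondeg_right assms by blast
  then show ?thesis
    using False assms by (simp, intro finsum_nontrivial_character[OF G.is_group finite_left])
      (auto simp: pair_in pair_mult_left)
qed

lemma pair_cancel:
  assumes "g \<in> carrier G" "x \<in> carrier Q" "h \<in> carrier G" "y \<in> carrier Q"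
  shows "\<beta> h x \<otimes> \<beta> (inv\<^bsub>G\<^esub> g) x = \<beta> (h \<otimes>\<^bsub>G\<^esub> inv\<^bsub>G\<^esub> g) x"
    and "\<beta> (inv\<^bsub>G\<^esub> g) x \<otimes> \<beta> g y = \<beta> g (inv\<^bsub>Q\<^esub> x \<otimes>\<^bsub>Q\<^esub> y)"
proof -
  show "\<beta> h x \<otimes> \<beta> (inv\<^bsub>G\<^esub> g) x = \<beta> (h \<otimes>\<^bsub>G\<^esub> inv\<^bsub>G\<^esub> g) x"
    using assms by (simp add: pair_mult_left)
  have "\<beta> (inv\<^bsub>G\<^esub> g) x \<otimes> \<beta> g x = \<one>"
    using assms by (simp add: pair_mult_left[symmetric] pair_one)
  moreover have "\<beta> g (inv\<^bsub>Q\<^esub> x) \<otimes> \<beta> g x = \<one>"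
    using assms by (simp add: pair_mult_right[symmetric] pair_one)
  ultimately have "\<beta> (inv\<^bsub>G\<^esub> g) x = \<beta> g (inv\<^bsub>Q\<^esub> x)"
    using assms pair_closed[of g x] by (metis DiffE G.inv_closed Q.inv_closed insertI1 m_rcancel pair_in)
  then show "\<beta> (inv\<^bsub>G\<^esub> g) x \<otimes> \<beta> g y = \<beta> g (inv\<^bsub>Q\<^esub> x \<otimes>\<^bsub>Q\<^esub> y)"
    using assms by (simp add: pair_mult_right)
qed

text \<open>The coefficient of the character of \<open>g\<close> is the average of \<open>f x * \<beta> g\<inverse> x\<close> over all \<open>x\<close>. That the
  expansion with these coefficients is \<open>f\<close> follows from \<open>sum_over_left\<close>: exchanging the sums leaves
  only the term with \<open>x = y\<close>.\<close>

lemma expansion_exists: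
  assumes f: "f \<in> carrier Q \<rightarrow> carrier R"
  obtains c where "c \<in> carrier G \<rightarrow> carrier R"
    and "\<And>y. y \<in> carrier Q \<Longrightarrow> f y = (\<Oplus>g\<in>carrier G. c g \<otimes> \<beta> g y)"
proof -
  let ?N = "add_pow R (order G) \<one>"
  have N: "?N \<in> Units R" using order_nonzero by (simp add: field_Units)
  define c where "c g = inv ?N \<otimes> (\<Oplus>x\<in>carrier Q. f x \<otimes> \<beta> (inv\<^bsub>G\<^esub> g) x)" for g
  have fc: "f x \<in> carrier R" if "x \<in> carrier Q" for x using f that by auto
  note cl = fc pair_in N
  have c: "c \<in> carrier G \<rightarrow> carrier R"
    unfolding c_def using cl by (auto intro!: finsum_closed m_closed)
  have "(\<Oplus>g\<in>carrier G. c g \<otimes> \<beta> g y) = f y" if y: "y \<in> carrier Q" for y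
  proof -
    have "(\<Oplus>g\<in>carrier G. c g \<otimes> \<beta> g y)
        = (\<Oplus>g\<in>carrier G. inv ?N \<otimes> (\<Oplus>x\<in>carrier Q. f x \<otimes> \<beta> g (inv\<^bsub>Q\<^esub> x \<otimes>\<^bsub>Q\<^esub> y)))"
    proof (intro finsum_cong')
      fix g assume g: "g \<in> carrier G"
      have "c g \<otimes> \<beta> g y = inv ?N \<otimes> ((\<Oplus>x\<in>carrier Q. f x \<otimes> \<beta> (inv\<^bsub>G\<^esub> g) x) \<otimes> \<beta> g y)"
        unfolding c_def using cl g y by (intro m_assoc) (auto intro!: finsum_closed)
      also have "(\<Oplus>x\<in>carrier Q. f x \<otimes> \<beta> (inv\<^bsub>G\<^esub> g) x) \<otimes> \<beta> g y
          = (\<Oplus>x\<in>carrier Q. f x \<otimes> \<beta> (inv\<^bsub>G\<^esub> g) x \<otimes> \<beta> g y)"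
        using cl g y finite_right by (intro finsum_ldistr) auto
      also have "\<dots> = (\<Oplus>x\<in>carrier Q. f x \<otimes> \<beta> g (inv\<^bsub>Q\<^esub> x \<otimes>\<^bsub>Q\<^esub> y))"
        using cl g y by (intro finsum_cong') (auto simp: m_assoc pair_cancel(2))
      finally show "c g \<otimes> \<beta> g y = inv ?N \<otimes> (\<Oplus>x\<in>carrier Q. f x \<otimes> \<beta> g (inv\<^bsub>Q\<^esub> x \<otimes>\<^bsub>Q\<^esub> y))" .
    qed (use cl y in \<open>auto intro!: finsum_closed m_closed\<close>)
    also have "\<dots> = inv ?N \<otimes> (\<Oplus>g\<in>carrier G. \<Oplus>x\<in>carrier Q. f x \<otimes> \<beta> g (inv\<^bsub>Q\<^esub> x \<otimes>\<^bsub>Q\<^esub> y))"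
      using cl y finite_left by (intro finsum_rdistr[symmetric]) (auto intro!: finsum_closed)
    also have "(\<Oplus>g\<in>carrier G. \<Oplus>x\<in>carrier Q. f x \<otimes> \<beta> g (inv\<^bsub>Q\<^esub> x \<otimes>\<^bsub>Q\<^esub> y))
        = (\<Oplus>x\<in>carrier Q. \<Oplus>g\<in>carrier G. f x \<otimes> \<beta> g (inv\<^bsub>Q\<^esub> x \<otimes>\<^bsub>Q\<^esub> y))"
      using cl y finite_left finite_right by (intro finsum_swap) auto
    also have "\<dots> = (\<Oplus>x\<in>carrier Q. f x \<otimes> (if x = y then ?N else \<zero>))"
    proof (intro finsum_cong')
      fix x assume x: "x \<in> carrier Q"
      have "inv\<^bsub>Q\<^esub> x \<otimes>\<^bsub>Q\<^esub> y = \<one>\<^bsub>Q\<^esub> \<longleftrightarrow> x = y"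
        using x y by (metis Q.inv_closed Q.inv_equality Q.inv_inv Q.l_inv)
      then show "(\<Oplus>g\<in>carrier G. f x \<otimes> \<beta> g (inv\<^bsub>Q\<^esub> x \<otimes>\<^bsub>Q\<^esub> y)) = f x \<otimes> (if x = y then ?N else \<zero>)"
        using cl x y finite_left
        by (subst finsum_rdistr[symmetric]) (auto simp: sum_over_left)
    qed (use cl in auto)
    also have "\<dots> = f y \<otimes> ?N"
      using y finite_right cl by (intro finsum_delta) auto
    finally show ?thesis using cl y by (simp add: m_comm[of "f y"] m_assoc[symmetric])
  qed
  then show thesis using c that by metis
qed

text \<open>By \<open>sum_over_right\<close>, multiplying the expansion by \<open>\<beta> g\<inverse> x\<close> and summing over \<open>x\<close> recovers \<open>c g\<close> up to
  the order of the group.\<close>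

lemma expansion_unique:
  assumes c: "c \<in> carrier G \<rightarrow> carrier R" and c': "c' \<in> carrier G \<rightarrow> carrier R"
    and eq: "\<And>x. x \<in> carrier Q \<Longrightarrow>
      (\<Oplus>h\<in>carrier G. c h \<otimes> \<beta> h x) = (\<Oplus>h\<in>carrier G. c' h \<otimes> \<beta> h x)"
    and g: "g \<in> carrier G"
  shows "c g = c' g"
proof -
  let ?N = "add_pow R (order G) \<one>"
  have main: "(\<Oplus>x\<in>carrier Q. (\<Oplus>h\<in>carrier G. c h \<otimes> \<beta> h x) \<otimes> \<beta> (inv\<^bsub>G\<^esub> g) x) = c g \<otimes> ?N"
    if "c \<in> carrier G \<rightarrow> carrier R" for c
  proof -
    have cc: "c h \<in> carrier R" if "h \<in> carrier G" for h using \<open>c \<in> _\<close> that by auto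
    note cl = cc pair_in
    have "(\<Oplus>x\<in>carrier Q. (\<Oplus>h\<in>carrier G. c h \<otimes> \<beta> h x) \<otimes> \<beta> (inv\<^bsub>G\<^esub> g) x)
        = (\<Oplus>x\<in>carrier Q. \<Oplus>h\<in>carrier G. c h \<otimes> \<beta> (h \<otimes>\<^bsub>G\<^esub> inv\<^bsub>G\<^esub> g) x)"
    proof (intro finsum_cong')
      fix x assume x: "x \<in> carrier Q"
      have "(\<Oplus>h\<in>carrier G. c h \<otimes> \<beta> h x) \<otimes> \<beta> (inv\<^bsub>G\<^esub> g) x
          = (\<Oplus>h\<in>carrier G. c h \<otimes> \<beta> h x \<otimes> \<beta> (inv\<^bsub>G\<^esub> g) x)"
        using cl g x finite_left by (intro finsum_ldistr) auto
      also have "\<dots> = (\<Oplus>h\<in>carrier G. c h \<otimes> \<beta> (h \<otimes>\<^bsub>G\<^esub> inv\<^bsub>G\<^esub> g) x)"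
        using cl g x by (intro finsum_cong') (auto simp: m_assoc pair_cancel(1))
      finally show "(\<Oplus>h\<in>carrier G. c h \<otimes> \<beta> h x) \<otimes> \<beta> (inv\<^bsub>G\<^esub> g) x
          = (\<Oplus>h\<in>carrier G. c h \<otimes> \<beta> (h \<otimes>\<^bsub>G\<^esub> inv\<^bsub>G\<^esub> g) x)" .
    qed (use cl g in \<open>auto intro!: finsum_closed\<close>)
    also have "\<dots> = (\<Oplus>h\<in>carrier G. \<Oplus>x\<in>carrier Q. c h \<otimes> \<beta> (h \<otimes>\<^bsub>G\<^esub> inv\<^bsub>G\<^esub> g) x)"
      using cl g finite_left finite_right by (intro finsum_swap) auto
    also have "\<dots> = (\<Oplus>h\<in>carrier G. c h \<otimes> (if h = g then ?N else \<zero>))"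
    proof (intro finsum_cong')
      fix h assume h: "h \<in> carrier G"
      have "h \<otimes>\<^bsub>G\<^esub> inv\<^bsub>G\<^esub> g = \<one>\<^bsub>G\<^esub> \<longleftrightarrow> h = g"
        using g h by (metis G.inv_closed G.inv_equality G.inv_inv G.r_inv)
      then show "(\<Oplus>x\<in>carrier Q. c h \<otimes> \<beta> (h \<otimes>\<^bsub>G\<^esub> inv\<^bsub>G\<^esub> g) x) = c h \<otimes> (if h = g then ?N else \<zero>)"
        using cl g h finite_right
        by (subst finsum_rdistr[symmetric]) (auto simp: sum_over_right)
    qed (use cl in auto)
    also have "\<dots> = c g \<otimes> ?N"
      using g finite_left cl by (intro finsum_delta) auto
    finally show ?thesis .
  qed
  have "c g \<otimes> ?N = (\<Oplus>x\<in>carrier Q. (\<Oplus>h\<in>carrier G. c h \<otimes> \<beta> h x) \<otimes> \<beta> (inv\<^bsub>G\<^esub> g) x)"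
    using main[OF c] by simp
  also have "\<dots> = (\<Oplus>x\<in>carrier Q. (\<Oplus>h\<in>carrier G. c' h \<otimes> \<beta> h x) \<otimes> \<beta> (inv\<^bsub>G\<^esub> g) x)"
  proof -
    have "c' h \<in> carrier R" if "h \<in> carrier G" for h using c' that by auto
    then show ?thesis
      using g by (intro finsum_cong') (auto simp: eq pair_in intro!: finsum_closed m_closed)
  qed
  also have "\<dots> = c' g \<otimes> ?N" using main[OF c'] .
  finally show ?thesis
    using c c' g order_nonzero by (subst (asm) m_rcancel) auto
qed

end

section \<open>The pairing of roots of unity with residue classes\<close>

definition roots_of_unity :: "('k, 'r) ring_scheme \<Rightarrow> nat \<Rightarrow> 'k monoid" where
  "roots_of_unity K d =
     \<lparr>carrier = {x \<in> carrier K. x [^]\<^bsub>K\<^esub> d = \<one>\<^bsub>K\<^esub>}, monoid.mult = (\<otimes>\<^bsub>K\<^esub>), one = \<one>\<^bsub>K\<^esub>\<rparr>"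

lemma roots_of_unity_simps [simp]:
  "carrier (roots_of_unity K d) = {x \<in> carrier K. x [^]\<^bsub>K\<^esub> d = \<one>\<^bsub>K\<^esub>}"
  "x \<otimes>\<^bsub>roots_of_unity K d\<^esub> y = x \<otimes>\<^bsub>K\<^esub> y"
  "\<one>\<^bsub>roots_of_unity K d\<^esub> = \<one>\<^bsub>K\<^esub>"
  by (simp_all add: roots_of_unity_def)

context field
begin

lemma group_roots_of_unity:
  assumes "0 < d"
  shows "group (roots_of_unity R d)"
proof (rule groupI)
  fix x assume x: "x \<in> carrier (roots_of_unity R d)"
  have "x [^] (d - 1) \<otimes> x = x [^] d"
    using assms by (cases d) auto
  moreover have "(x [^] (d - 1)) [^] d = \<one>"
  proof -
    have "(x [^] (d - 1)) [^] d = (x [^] d) [^] (d - 1)"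
      using nat_pow_pow[of x "d - 1" d] nat_pow_pow[of x d "d - 1"] x
      by (metis (lifting) mem_Collect_eq mult.commute roots_of_unity_simps(1))
    then show ?thesis using x by simp
  qed
  ultimately show "\<exists>y\<in>carrier (roots_of_unity R d). y \<otimes>\<^bsub>roots_of_unity R d\<^esub> x = \<one>\<^bsub>roots_of_unity R d\<^esub>"
    using x by (intro bexI[of _ "x [^] (d - 1)"]) auto
qed (auto simp: nat_pow_distrib m_assoc)

lemma nat_pow_mod_exponent:
  assumes "x \<in> carrier R" "x [^] d = \<one>"
  shows "x [^] (k mod d) = x [^] (k :: nat)"
proof -
  have "x [^] k = x [^] (d * (k div d) + k mod d)" by simp
  also have "\<dots> = (x [^] d) [^] (k div d) \<otimes> x [^] (k mod d)"
    using assms(1) by (simp only: nat_pow_mult[symmetric] nat_pow_pow)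
  finally show ?thesis using assms by simp
qed

lemma power_root_of_unity_nonzero:
  assumes "0 < (d :: nat)" "x \<in> carrier R" "x [^] d = \<one>"
  shows "x [^] (k :: nat) \<noteq> \<zero>"
proof -
  have "x \<noteq> \<zero>" using assms nat_pow_zero[of d] by auto
  then have "x \<in> Units R" using assms by (simp add: field_Units)
  then have "x [^] k \<in> Units R" by (rule Units_pow_closed)
  then show ?thesis by (simp add: field_Units)
qed

text \<open>The integers are representatives of classes modulo \<open>d\<close> and \<open>m\<close>; the value is independent of their
  choice when the two entries of \<open>g\<close> are a \<open>d\<close>-th and an \<open>m\<close>-th root of unity.\<close>

definition unity_pairing :: "'a \<times> 'a \<Rightarrow> int \<times> int \<Rightarrow> 'a" where
  "unity_pairing g x = fst g [^] nat (fst x) \<otimes> snd g [^] nat (snd x)"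

text \<open>Non-degeneracy on the side of the integers is a root count: an exponent \<open>0 < k < e\<close> with \<open>x ^ k = 1\<close>
  for all \<open>e\<close>-th roots of unity \<open>x\<close> would give the polynomial \<open>x ^ k - 1\<close> more than \<open>k\<close> roots.\<close>

lemma perfect_pairing_roots_of_unity:
  assumes d: "0 < d" and m: "0 < m" and card_dm: "card {x \<in> carrier R. x [^] (d * m) = \<one>} = d * m"
  shows "perfect_pairing R (roots_of_unity R d \<times>\<times> roots_of_unity R m)
           (integer_mod_group d \<times>\<times> integer_mod_group m) unity_pairing"
proof -
  let ?G = "roots_of_unity R d \<times>\<times> roots_of_unity R m"
  let ?Q = "integer_mod_group d \<times>\<times> integer_mod_group m"
  have cd: "card {x \<in> carrier R. x [^] d = \<one>} = d"
    using card_roots_of_unity_factor[OF d m card_dm] .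
  have cm: "card {x \<in> carrier R. x [^] m = \<one>} = m"
    using card_roots_of_unity_factor[OF m d] card_dm by (simp add: mult.commute)
  have oG: "order ?G = d * m" by (simp add: order_def cd cm card_cartesian_product)
  have oQ: "order ?Q = d * m"
    using d m by (simp add: order_def carrier_integer_mod_group card_cartesian_product)
  have sep: "\<exists>x\<in>carrier R. x [^] e = \<one> \<and> x [^] (nat k) \<noteq> \<one>"
    if "card {x \<in> carrier R. x [^] e = \<one>} = e" "0 < k" "k < int e" for e k
  proof (rule ccontr)
    assume "\<not> ?thesis"
    then have sub: "{x \<in> carrier R. x [^] e = \<one>} \<subseteq> {x \<in> carrier R. x [^] nat k = \<one>}" by auto
    have "e \<le> nat k"
      using card_mono[OF card_roots_of_unity_le(1) sub] card_roots_of_unity_le(2)[of "nat k"] that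
      by simp
    then show False using that by linarith
  qed
  have ipow: "x [^] k \<in> carrier R" if "x \<in> carrier R" "0 \<le> k" for x and k :: int
    using nat_pow_closed[of x "nat k"] that by simp
  have addpow: "x [^] ((i + j) mod int e) = x [^] i \<otimes> x [^] j"
    if "0 < e" "x \<in> carrier R" "x [^] e = \<one>" "0 \<le> i" "0 \<le> j" for x e i j
  proof -
    have "nat ((i + j) mod int e) = (nat i + nat j) mod e"
      using that by (simp add: nat_mod_distrib nat_add_distrib)
    then have "x [^] nat ((i + j) mod int e) = x [^] nat i \<otimes> x [^] nat j"
      using that by (simp only: nat_pow_mod_exponent nat_pow_mult[symmetric])
    then show ?thesis using that by simp
  qed
  show ?thesis
  proof (intro perfect_pairing.intro perfect_pairing_axioms.intro field_axioms)
    show "group ?G" using d m by (intro DirProd_group group_roots_of_unity)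
    show "group ?Q" by (intro DirProd_group group_integer_mod_group)
    show "finite (carrier ?G)"
      using card_roots_of_unity_le(1) d m by simp
    show "finite (carrier ?Q)" using d m by (simp add: carrier_integer_mod_group)
    show "order ?G = order ?Q" using oG oQ by simp
    show "add_pow R (order ?G) \<one> \<noteq> \<zero>"
      unfolding oG using d m card_dm by (intro of_nat_card_roots_of_unity_nonzero) auto
  next
    fix g x assume "g \<in> carrier ?G" "x \<in> carrier ?Q"
    then show "unity_pairing g x \<in> carrier R - {\<zero>}"
      using power_root_of_unity_nonzero d m
      by (auto simp: unity_pairing_def integral_iff)
  next
    fix g h x assume "g \<in> carrier ?G" "h \<in> carrier ?G" "x \<in> carrier ?Q"
    then show "unity_pairing (g \<otimes>\<^bsub>?G\<^esub> h) x = unity_pairing g x \<otimes> unity_pairing h x"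
      by (auto simp: unity_pairing_def nat_pow_distrib m_ac)
  next
    fix g x y assume "g \<in> carrier ?G" "x \<in> carrier ?Q" "y \<in> carrier ?Q"
    then show "unity_pairing g (x \<otimes>\<^bsub>?Q\<^esub> y) = unity_pairing g x \<otimes> unity_pairing g y"
      using d m by (auto simp: unity_pairing_def addpow ipow m_ac carrier_integer_mod_group)
  next
    fix g assume g: "g \<in> carrier ?G" "g \<noteq> \<one>\<^bsub>?G\<^esub>"
    obtain \<xi> \<eta> where [simp]: "g = (\<xi>, \<eta>)" by (cases g)
    show "\<exists>x\<in>carrier ?Q. unity_pairing g x \<noteq> \<one>"
    proof (cases "\<xi> = \<one>")
      case True
      then have "\<eta> \<noteq> \<one>" "m \<noteq> 1" using g by auto
      then show ?thesis using g
        by (intro bexI[of _ "(0, 1)"]) (auto simp: unity_pairing_def)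
    next
      case False
      then have "d \<noteq> 1" using g by auto
      then show ?thesis using g False
        by (intro bexI[of _ "(1, 0)"]) (auto simp: unity_pairing_def)
    qed
  next
    fix x assume x: "x \<in> carrier ?Q" "x \<noteq> \<one>\<^bsub>?Q\<^esub>"
    obtain i j where ij: "x = (i, j)" by (cases x)
    have b: "0 \<le> i" "i < int d" "0 \<le> j" "j < int m"
      using x d m by (auto simp: ij carrier_integer_mod_group)
    show "\<exists>g\<in>carrier ?G. unity_pairing g x \<noteq> \<one>"
    proof (cases "i = 0")
      case True
      then obtain \<eta> where "\<eta> \<in> carrier R" "\<eta> [^] m = \<one>" "\<eta> [^] nat j \<noteq> \<one>"
        using sep[OF cm, of j] b x by (auto simp: ij)
      then show ?thesis using True
        by (intro bexI[of _ "(\<one>, \<eta>)"]) (auto simp: unity_pairing_def ij)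
    next
      case False
      then obtain \<xi> where "\<xi> \<in> carrier R" "\<xi> [^] d = \<one>" "\<xi> [^] nat i \<noteq> \<one>"
        using sep[OF cd, of i] b by auto
      then show ?thesis
        by (intro bexI[of _ "(\<xi>, \<one>)"]) (auto simp: unity_pairing_def ij)
    qed
  qed
qed

end

section \<open>The algebra of functions on a finite set\<close>

context field
begin

lemma power_algebra_simps [simp]:
  "carrier (power_algebra R n) = (\<Pi>\<^sub>E i\<in>{..<n}. carrier R)"
  "f \<otimes>\<^bsub>power_algebra R n\<^esub> g = (\<lambda>i\<in>{..<n}. f i \<otimes> g i)"
  "\<one>\<^bsub>power_algebra R n\<^esub> = (\<lambda>i\<in>{..<n}. \<one>)"
  "\<zero>\<^bsub>power_algebra R n\<^esub> = (\<lambda>i\<in>{..<n}. \<zero>)"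
  "f \<oplus>\<^bsub>power_algebra R n\<^esub> g = (\<lambda>i\<in>{..<n}. f i \<oplus> g i)"
  "a \<odot>\<^bsub>power_algebra R n\<^esub> f = (\<lambda>i\<in>{..<n}. a \<otimes> f i)"
  by (simp_all add: power_algebra_def)

lemma power_algebra_component:
  "f \<in> (\<Pi>\<^sub>E i\<in>{..<n}. carrier R) \<Longrightarrow> i < n \<Longrightarrow> f i \<in> carrier R"
  by auto

lemma algebra_power_algebra: "algebra R (power_algebra R n)"
proof (rule algebraI)
  let ?A = "power_algebra R n"
  note mem = power_algebra_component
  have res: "(\<lambda>i\<in>{..<n}. f i) = f" if "f \<in> (\<Pi>\<^sub>E i\<in>{..<n}. carrier R)" for f
    using that by (rule PiE_restrict)
  show "cring R" by (rule is_cring)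
  show "cring ?A"
  proof (rule cringI)
    show "abelian_group ?A"
    proof (rule abelian_groupI)
      fix f assume f: "f \<in> carrier ?A"
      show "\<exists>g\<in>carrier ?A. g \<oplus>\<^bsub>?A\<^esub> f = \<zero>\<^bsub>?A\<^esub>"
        using f by (intro bexI[of _ "\<lambda>i\<in>{..<n}. \<ominus> f i"]) (simp_all add: l_neg mem cong: restrict_cong)
    qed (simp_all add: a_assoc mem res cong: restrict_cong, simp_all add: a_comm mem cong: restrict_cong)
    show "comm_monoid ?A"
      by (rule comm_monoidI)
        (simp_all add: m_assoc mem res cong: restrict_cong, simp_all add: m_comm mem cong: restrict_cong)
  qed (simp add: l_distr mem cong: restrict_cong)
qed (simp_all add: m_assoc l_distr r_distr power_algebra_component PiE_restrict cong: restrict_cong)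

lemma finsum_power_algebra:
  assumes "finite I" "f \<in> I \<rightarrow> carrier (power_algebra R n)"
  shows "finsum (power_algebra R n) f I = (\<lambda>i\<in>{..<n}. \<Oplus>x\<in>I. f x i)"
proof -
  interpret A: algebra R "power_algebra R n" by (rule algebra_power_algebra)
  show ?thesis
    using assms
  proof (induction I rule: finite_induct)
    case (insert x I)
    have c: "f y i \<in> carrier R" if "y \<in> insert x I" "i < n" for y i
    proof -
      have "f y \<in> carrier (power_algebra R n)" using insert.prems that by blast
      then show ?thesis using that by auto
    qed
    have "finsum (power_algebra R n) f (insert x I)
        = f x \<oplus>\<^bsub>power_algebra R n\<^esub> finsum (power_algebra R n) f I"
      using insert by (intro A.M.finsum_insert) auto
    also have "\<dots> = (\<lambda>i\<in>{..<n}. f x i \<oplus> (\<Oplus>y\<in>I. f y i))"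
      using insert by (auto simp: fun_eq_iff)
    also have "\<dots> = (\<lambda>i\<in>{..<n}. \<Oplus>y\<in>insert x I. f y i)"
      using insert.hyps c by (intro restrict_ext, subst finsum_insert) auto
    finally show ?case .
  qed simp
qed

end

section \<open>The Galois covering of a finite grading\<close>

lemma linear_mapsI:
  assumes "\<And>u. u \<in> carrier M \<Longrightarrow> f u \<in> carrier N"
    and "\<And>u v. u \<in> carrier M \<Longrightarrow> v \<in> carrier M \<Longrightarrow> f (u \<oplus>\<^bsub>M\<^esub> v) = f u \<oplus>\<^bsub>N\<^esub> f v"
    and "\<And>a u. a \<in> carrier K \<Longrightarrow> u \<in> carrier M \<Longrightarrow> f (a \<odot>\<^bsub>M\<^esub> u) = a \<odot>\<^bsub>N\<^esub> f u"
  shows "f \<in> linear_maps K M N"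
  using assms by (simp add: linear_maps_def)

lemma one_object_category_simps [simp]:
  "Obj (one_object_category A) = {()}"
  "Mor (one_object_category A) x y = A"
  "Comp (one_object_category A) x y z g f = g \<otimes>\<^bsub>A\<^esub> f"
  "Ident (one_object_category A) x = \<one>\<^bsub>A\<^esub>"
  by (simp_all add: one_object_category_def)

lemma star_space_one_object_category [simp]: "star_space (one_object_category A) b j = A"
  by (cases j) simp_all

lemma k_category_one_object_category:
  assumes "field K" "algebra K A"
  shows "k_category K (one_object_category A)"
proof -
  interpret K: field K by fact
  interpret A: algebra K A by fact
  have right: "g \<otimes>\<^bsub>A\<^esub> (a \<odot>\<^bsub>A\<^esub> f) = a \<odot>\<^bsub>A\<^esub> (g \<otimes>\<^bsub>A\<^esub> f)"
    if "a \<in> carrier K" "f \<in> carrier A" "g \<in> carrier A" for a f g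
    using that by (simp add: A.m_comm[of g] A.smult_assoc2)
  show ?thesis
    by (intro k_category.intro k_category_axioms.intro K.field_axioms)
      (simp_all add: linear_maps_def A.module_axioms A.l_distr A.r_distr A.smult_assoc2
        A.m_assoc right)
qed

text \<open>The two decomposition axioms say that the module is the direct sum of its components. They are
  stated for total functions, of which only the values on \<open>carrier G\<close> count.\<close>

locale finite_grading = algebra R M + R: field R + G: group G
  for R :: "('a, 'r) ring_scheme" (structure) and M :: "('a, 'c) module" (structure)
    and G :: "('g, 'i) monoid_scheme" (structure) +
  fixes component :: "'g \<Rightarrow> 'c set"
  assumes finite_G: "finite (carrier G)"
    and component_submodule: "g \<in> carrier G \<Longrightarrow> submodule (component g) R M"
    and component_nonzero: "g \<in> carrier G \<Longrightarrow> component g \<noteq> {\<zero>\<^bsub>M\<^esub>}"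
    and component_mult: "\<lbrakk>g \<in> carrier G; h \<in> carrier G; a \<in> component g; b \<in> component h\<rbrakk> \<Longrightarrow>
          a \<otimes>\<^bsub>M\<^esub> b \<in> component (g \<otimes>\<^bsub>G\<^esub> h)"
    and component_one: "\<one>\<^bsub>M\<^esub> \<in> component \<one>\<^bsub>G\<^esub>"
    and decomposition_exists:
      "a \<in> carrier M \<Longrightarrow> \<exists>s. (\<forall>g\<in>carrier G. s g \<in> component g) \<and> a = (\<Oplus>\<^bsub>M\<^esub>g\<in>carrier G. s g)"
    and decomposition_unique:
      "\<lbrakk>\<forall>g\<in>carrier G. s g \<in> component g; \<forall>g\<in>carrier G. t g \<in> component g;
        (\<Oplus>\<^bsub>M\<^esub>g\<in>carrier G. s g) = (\<Oplus>\<^bsub>M\<^esub>g\<in>carrier G. t g); g \<in> carrier G\<rbrakk> \<Longrightarrow> s g = t g"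
begin

lemma component_subset: "g \<in> carrier G \<Longrightarrow> a \<in> component g \<Longrightarrow> a \<in> carrier M"
  using component_submodule[THEN submoduleE(1)] by blast

lemma component_closed:
  assumes "g \<in> carrier G"
  shows "\<zero>\<^bsub>M\<^esub> \<in> component g"
    and "a \<in> component g \<Longrightarrow> b \<in> component g \<Longrightarrow> a \<oplus>\<^bsub>M\<^esub> b \<in> component g"
    and "k \<in> carrier R \<Longrightarrow> a \<in> component g \<Longrightarrow> k \<odot>\<^bsub>M\<^esub> a \<in> component g"
    and "a \<in> component g \<Longrightarrow> \<ominus>\<^bsub>M\<^esub> a \<in> component g"
proof -
  show "\<zero>\<^bsub>M\<^esub> \<in> component g"
    using component_submodule[OF assms] by (metis submodule.axioms(1) subgroup.one_closed monoid.simps(2))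
qed (use component_submodule[OF assms] submoduleE(3-5) in blast)+

end

text \<open>The objects and the morphisms of the smash product are only copies of the elements of \<open>G\<close> and of \<open>M\<close>,
  identified with them by \<open>lab\<close> and \<open>val\<close>. So the category can be formed inside any types that are large
  enough, as the universal property requires.\<close>

locale smash_product = finite_grading R M G component
  for R :: "('a, 'r) ring_scheme" (structure) and M :: "('a, 'c) module" (structure)
    and G :: "('g, 'i) monoid_scheme" (structure)
    and component :: "'g \<Rightarrow> 'c set" +
  fixes obs :: "'o set" and lab :: "'o \<Rightarrow> 'g" and codes :: "'v set" and val :: "'v \<Rightarrow> 'c"
  assumes lab_bij: "bij_betw lab obs (carrier G)"
    and val_bij: "bij_betw val codes (carrier M)"
begin

definition "code = inv_into codes val"

lemma val_code [simp]: "a \<in> carrier M \<Longrightarrow> val (code a) = a"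
  and code_in [simp]: "a \<in> carrier M \<Longrightarrow> code a \<in> codes"
  and code_val [simp]: "v \<in> codes \<Longrightarrow> code (val v) = v"
  and val_in [simp]: "v \<in> codes \<Longrightarrow> val v \<in> carrier M"
  using val_bij unfolding code_def
  by (auto simp: bij_betw_def f_inv_into_f inv_into_into inv_into_f_f)

lemma val_inj: "u \<in> codes \<Longrightarrow> v \<in> codes \<Longrightarrow> val u = val v \<Longrightarrow> u = v"
  using val_bij by (auto simp: bij_betw_def inj_on_def)

definition deg :: "'o \<Rightarrow> 'o \<Rightarrow> 'g" where
  "deg x y = inv\<^bsub>G\<^esub> lab x \<otimes>\<^bsub>G\<^esub> lab y"

definition smash :: "('a, 'o, 'v) kcategory" where
  "smash = \<lparr>Obj = obs,
     Mor = (\<lambda>x y. \<lparr>carrier = {v \<in> codes. val v \<in> component (deg x y)},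
       monoid.mult = undefined, one = undefined, zero = code \<zero>\<^bsub>M\<^esub>,
       add = (\<lambda>u v. code (val u \<oplus>\<^bsub>M\<^esub> val v)), smult = (\<lambda>a u. code (a \<odot>\<^bsub>M\<^esub> val u))\<rparr>),
     Comp = (\<lambda>x y z g f. code (val g \<otimes>\<^bsub>M\<^esub> val f)), Ident = (\<lambda>x. code \<one>\<^bsub>M\<^esub>)\<rparr>"

definition degree_forget :: "('o, 'v, unit, 'c) kfunctor" where
  "degree_forget = \<lparr>FObj = (\<lambda>_. ()), FMor = (\<lambda>_ _. val)\<rparr>"

lemma smash_simps [simp]:
  "Obj smash = obs"
  "v \<in> carrier (Mor smash x y) \<longleftrightarrow> v \<in> codes \<and> val v \<in> component (deg x y)"
  "\<zero>\<^bsub>Mor smash x y\<^esub> = code \<zero>\<^bsub>M\<^esub>"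
  "u \<oplus>\<^bsub>Mor smash x y\<^esub> v = code (val u \<oplus>\<^bsub>M\<^esub> val v)"
  "a \<odot>\<^bsub>Mor smash x y\<^esub> u = code (a \<odot>\<^bsub>M\<^esub> val u)"
  "Comp smash x y z g f = code (val g \<otimes>\<^bsub>M\<^esub> val f)"
  "Ident smash x = code \<one>\<^bsub>M\<^esub>"
  by (auto simp: smash_def)

lemma degree_forget_simps [simp]:
  "FObj degree_forget x = ()" "FMor degree_forget x y = val"
  by (simp_all add: degree_forget_def)

lemma lab_in [simp]: "x \<in> obs \<Longrightarrow> lab x \<in> carrier G"
  using lab_bij by (auto simp: bij_betw_def)

lemma deg_in [simp]: "x \<in> obs \<Longrightarrow> y \<in> obs \<Longrightarrow> deg x y \<in> carrier G"
  by (simp add: deg_def)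

lemma deg_self [simp]: "x \<in> obs \<Longrightarrow> deg x x = \<one>\<^bsub>G\<^esub>"
  by (simp add: deg_def)

lemma deg_mult: "\<lbrakk>x \<in> obs; y \<in> obs; z \<in> obs\<rbrakk> \<Longrightarrow> deg x y \<otimes>\<^bsub>G\<^esub> deg y z = deg x z"
proof -
  assume "x \<in> obs" "y \<in> obs" "z \<in> obs"
  moreover from this have "lab y \<otimes>\<^bsub>G\<^esub> (inv\<^bsub>G\<^esub> lab y \<otimes>\<^bsub>G\<^esub> lab z) = lab z"
    by (simp add: G.m_assoc[symmetric])
  ultimately show ?thesis unfolding deg_def by (simp add: G.m_assoc)
qed

lemma module_Mor:
  assumes "x \<in> obs" "y \<in> obs"
  shows "Module.module R (Mor smash x y)"
proof (rule Module.moduleI)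
  note cl = component_closed[OF deg_in[OF assms]]
  show "cring R" by (rule R.is_cring)
  show "abelian_group (Mor smash x y)"
  proof (rule abelian_groupI)
    fix u assume u: "u \<in> carrier (Mor smash x y)"
    show "\<exists>v\<in>carrier (Mor smash x y). v \<oplus>\<^bsub>Mor smash x y\<^esub> u = \<zero>\<^bsub>Mor smash x y\<^esub>"
      using u cl by (intro bexI[of _ "code (\<ominus>\<^bsub>M\<^esub> val u)"]) (auto simp: M.l_neg)
  next
    fix u v
    assume "u \<in> carrier (Mor smash x y)" "v \<in> carrier (Mor smash x y)"
    then show "u \<oplus>\<^bsub>Mor smash x y\<^esub> v = v \<oplus>\<^bsub>Mor smash x y\<^esub> u" by (simp add: M.a_comm)
  qed (simp_all add: cl M.a_assoc)
qed (simp_all add: component_closed[OF deg_in[OF assms]] smult_l_distr smult_r_distr smult_assoc1)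

text \<open>The composite of \<open>f : x \<rightarrow> y\<close> and \<open>g : y \<rightarrow> z\<close> is the product \<open>g f\<close> in \<open>M\<close>, while the degrees multiply in
  the order \<open>deg x y * deg y z\<close>; the commutativity of \<open>M\<close> reconciles the two orders for a group \<open>G\<close> that
  need not be commutative.\<close>

lemma k_category_smash: "k_category R smash"
proof -
  have mult: "val g \<otimes>\<^bsub>M\<^esub> val f \<in> component (deg x z)"
    if "x \<in> obs" "y \<in> obs" "z \<in> obs" "val f \<in> component (deg x y)" "val g \<in> component (deg y z)" 
      "f \<in> codes" "g \<in> codes" for x y z f g
    using component_mult[of "deg x y" "deg y z" "val f" "val g"] that
    by (simp add: deg_mult m_comm)
  show ?thesis
  proof (intro k_category.intro k_category_axioms.intro R.field_axioms, goal_cases)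
    case (3 x y z g)
    have "val g \<otimes>\<^bsub>M\<^esub> (a \<odot>\<^bsub>M\<^esub> val f) = a \<odot>\<^bsub>M\<^esub> (val g \<otimes>\<^bsub>M\<^esub> val f)"
      if "a \<in> carrier R" "f \<in> codes" for a f
      using 3 that by (simp add: m_comm[of "val g"] smult_assoc2)
    then show ?case
      using 3 mult by (intro linear_mapsI) (auto simp: r_distr)
  next
    case (4 x y z f)
    then show ?case
      using mult by (intro linear_mapsI) (auto simp: l_distr smult_assoc2)
  qed (auto simp: module_Mor component_one m_assoc)
qed

lemma k_functor_degree_forget: "k_functor R smash (one_object_category M) degree_forget"
  unfolding k_functor_def
  using k_category_smash k_category_one_object_category[OF R.field_axioms algebra_axioms]
  by (simp add: Pi_def linear_maps_def)

lemma connected_smash: "connected_kcategory smash"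
  unfolding connected_kcategory_def
proof safe
  fix x y assume xy: "x \<in> Obj smash" "y \<in> Obj smash"
  then obtain a where a: "a \<in> component (deg x y)" "a \<noteq> \<zero>\<^bsub>M\<^esub>"
    using component_nonzero[of "deg x y"] component_closed(1)[of "deg x y"] by auto
  then have "a \<in> carrier M" using component_subset[of "deg x y"] xy by simp
  moreover have "code a \<noteq> code \<zero>\<^bsub>M\<^esub>"
    using a \<open>a \<in> carrier M\<close> by (metis val_code M.zero_closed)
  ultimately have "nonzero_walk smash x [(x, y, code a, True)] y"
    using a xy by simp
  then show "\<exists>w. w \<noteq> [] \<and> nonzero_walk smash x w y" by blast
qed

lemma finite_obs: "finite obs"
  using lab_bij finite_G bij_betw_finite by blast

text \<open>For a fixed object, the degrees of the morphism spaces in either half of its star run through \<open>G\<close>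
  exactly once. So the star consists of two copies of the direct sum of all components, which is why
  the functor forgetting degrees is a covering.\<close>

lemma deg_bij:
  assumes x: "x \<in> obs"
  shows "bij_betw (\<lambda>y. deg x y) obs (carrier G)" and "bij_betw (\<lambda>y. deg y x) obs (carrier G)"
proof -
  have 1: "bij_betw (\<lambda>g. inv\<^bsub>G\<^esub> lab x \<otimes>\<^bsub>G\<^esub> g) (carrier G) (carrier G)"
    using x by (intro bij_betw_byWitness[where f' = "\<lambda>g. lab x \<otimes>\<^bsub>G\<^esub> g"])
      (auto simp: G.m_assoc[symmetric])
  have 2: "bij_betw (\<lambda>g. inv\<^bsub>G\<^esub> g \<otimes>\<^bsub>G\<^esub> lab x) (carrier G) (carrier G)"
    using x by (intro bij_betw_byWitness[where f' = "\<lambda>g. lab x \<otimes>\<^bsub>G\<^esub> inv\<^bsub>G\<^esub> g"])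
      (auto simp: G.m_assoc[symmetric] G.inv_mult_group G.m_assoc)
  show "bij_betw (\<lambda>y. deg x y) obs (carrier G)"
    using bij_betw_trans[OF lab_bij 1] by (simp add: o_def deg_def)
  show "bij_betw (\<lambda>y. deg y x) obs (carrier G)"
    using bij_betw_trans[OF lab_bij 2] by (simp add: o_def deg_def)
qed

lemma reindexed_decomposition_exists:
  assumes e: "bij_betw e obs (carrier G)" and a: "a \<in> carrier M"
  shows "\<exists>t. (\<forall>y\<in>obs. t y \<in> codes \<and> val (t y) \<in> component (e y)) \<and> a = (\<Oplus>\<^bsub>M\<^esub>y\<in>obs. val (t y))"
proof -
  obtain s where s: "\<forall>g\<in>carrier G. s g \<in> component g" "a = (\<Oplus>\<^bsub>M\<^esub>g\<in>carrier G. s g)"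
    using decomposition_exists[OF a] by blast
  have eG: "e y \<in> carrier G" if "y \<in> obs" for y using e that by (auto simp: bij_betw_def)
  have sM: "s g \<in> carrier M" if "g \<in> carrier G" for g using s(1) that component_subset by blast
  have "(\<Oplus>\<^bsub>M\<^esub>g\<in>e ` obs. s g) = (\<Oplus>\<^bsub>M\<^esub>y\<in>obs. s (e y))"
    using e sM by (intro M.finsum_reindex) (auto simp: bij_betw_def)
  also have "\<dots> = (\<Oplus>\<^bsub>M\<^esub>y\<in>obs. val (code (s (e y))))"
    using sM eG by (intro M.finsum_cong') auto
  finally have "a = (\<Oplus>\<^bsub>M\<^esub>y\<in>obs. val (code (s (e y))))"
    using s(2) e by (simp add: bij_betw_def)
  then show ?thesis
    using s(1) sM eG by (intro exI[of _ "\<lambda>y. code (s (e y))"]) auto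
qed

lemma reindexed_decomposition_unique:
  assumes e: "bij_betw e obs (carrier G)"
    and t: "\<forall>y\<in>obs. t y \<in> codes \<and> val (t y) \<in> component (e y)"
    and t': "\<forall>y\<in>obs. t' y \<in> codes \<and> val (t' y) \<in> component (e y)"
    and eq: "(\<Oplus>\<^bsub>M\<^esub>y\<in>obs. val (t y)) = (\<Oplus>\<^bsub>M\<^esub>y\<in>obs. val (t' y))"
    and y: "y \<in> obs"
  shows "t y = t' y"
proof -
  let ?f = "inv_into obs e"
  have inj: "inj_on e obs" and im: "e ` obs = carrier G" using e by (auto simp: bij_betw_def)
  have f: "?f g \<in> obs" "e (?f g) = g" if "g \<in> carrier G" for g
    using that im by (auto simp: inv_into_into f_inv_into_f)
  have re: "(\<Oplus>\<^bsub>M\<^esub>g\<in>carrier G. val (r (?f g))) = (\<Oplus>\<^bsub>M\<^esub>y\<in>obs. val (r y))"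
    if r: "\<forall>y\<in>obs. r y \<in> codes \<and> val (r y) \<in> component (e y)" for r
  proof -
    have "(\<Oplus>\<^bsub>M\<^esub>g\<in>e ` obs. val (r (?f g))) = (\<Oplus>\<^bsub>M\<^esub>y\<in>obs. val (r (?f (e y))))"
      using r inj by (intro M.finsum_reindex) auto
    also have "\<dots> = (\<Oplus>\<^bsub>M\<^esub>y\<in>obs. val (r y))"
      using r inj by (intro M.finsum_cong') auto
    finally show ?thesis by (simp add: im)
  qed
  have c: "\<forall>g\<in>carrier G. val (r (?f g)) \<in> component g"
    if r: "\<forall>y\<in>obs. r y \<in> codes \<and> val (r y) \<in> component (e y)" for r
    using r f by metis
  have "val (t (?f (e y))) = val (t' (?f (e y)))"
    using im y by (intro decomposition_unique[OF c[OF t] c[OF t']]) (auto simp: re t t' eq)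
  then show ?thesis using y inj t t' by (auto intro: val_inj)
qed

abbreviation "B \<equiv> one_object_category M"

lemma carrier_star:
  "s \<in> carrier (star smash x) \<longleftrightarrow>
     s \<in> extensional (obs <+> obs) \<and>
     (\<forall>y\<in>obs. s (Inl y) \<in> codes \<and> val (s (Inl y)) \<in> component (deg x y)) \<and>
     (\<forall>y\<in>obs. s (Inr y) \<in> codes \<and> val (s (Inr y)) \<in> component (deg y x))"
  using finite_obs by (auto simp: star_def direct_sum_def PiE_def Pi_def Plus_def)

lemma carrier_star_one_object:
  "carrier (star B b) = (\<Pi>\<^sub>E j\<in>{()} <+> {()}. carrier M)"
  by (auto simp: star_def direct_sum_def)

text \<open>The star map sums over the support only; as there are finitely many objects, the sum may be
  extended to all of them.\<close>

lemma star_map_eq: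
  assumes x: "x \<in> obs" and s: "s \<in> carrier (star smash x)"
  shows "star_map smash B degree_forget x s =
    (\<lambda>j\<in>{()} <+> {()}. case j of Inl _ \<Rightarrow> \<Oplus>\<^bsub>M\<^esub>y\<in>obs. val (s (Inl y))
                                | Inr _ \<Rightarrow> \<Oplus>\<^bsub>M\<^esub>y\<in>obs. val (s (Inr y)))"
proof -
  let ?S = "\<lambda>j. {i \<in> obs <+> obs. map_sum (FObj degree_forget) (FObj degree_forget) i = j \<and>
      s i \<noteq> \<zero>\<^bsub>star_space smash x i\<^esub>}"
  let ?f = "\<lambda>i. star_functor degree_forget x i (s i)"
  have fI: "?f (Inl y) = val (s (Inl y))" "?f (Inr y) = val (s (Inr y))" for y
    by simp_all
  have in_M: "val (s (Inl y)) \<in> carrier M" "val (s (Inr y)) \<in> carrier M" if "y \<in> obs" for y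
    using s that by (auto simp: carrier_star)
  have "finsum M ?f (?S (Inl ())) = (\<Oplus>\<^bsub>M\<^esub>i\<in>Inl ` obs. ?f i)"
    using finite_obs in_M by (intro M.add.finprod_mono_neutral_cong_left) auto
  also have "\<dots> = (\<Oplus>\<^bsub>M\<^esub>y\<in>obs. ?f (Inl y))"
    using in_M by (intro M.finsum_reindex) auto
  finally have 1: "finsum M ?f (?S (Inl ())) = (\<Oplus>\<^bsub>M\<^esub>y\<in>obs. val (s (Inl y)))"
    by simp
  have "finsum M ?f (?S (Inr ())) = (\<Oplus>\<^bsub>M\<^esub>i\<in>Inr ` obs. ?f i)"
    using finite_obs in_M by (intro M.add.finprod_mono_neutral_cong_left) auto
  also have "\<dots> = (\<Oplus>\<^bsub>M\<^esub>y\<in>obs. ?f (Inr y))"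
    using in_M by (intro M.finsum_reindex) auto
  finally have 2: "finsum M ?f (?S (Inr ())) = (\<Oplus>\<^bsub>M\<^esub>y\<in>obs. val (s (Inr y)))"
    by simp
  show ?thesis
    unfolding star_map_def using 1 2
    by (intro ext) (auto simp: restrict_def split: sum.split)
qed

lemma star_map_linear_iso:
  assumes x: "x \<in> obs"
  shows "star_map smash B degree_forget x \<in> linear_isos R (star smash x) (star B ())"
proof -
  let ?\<Phi> = "star_map smash B degree_forget x"
  have in_M: "val (s (Inl y)) \<in> carrier M" "val (s (Inr y)) \<in> carrier M"
    if "s \<in> carrier (star smash x)" "y \<in> obs" for s y
    using that by (auto simp: carrier_star)
  have closed: "?\<Phi> s \<in> carrier (star B ())" if "s \<in> carrier (star smash x)" for s
    using in_M[OF that] by (auto simp: star_map_eq[OF x that] carrier_star_one_object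
        split: sum.split intro!: M.finsum_closed)
  have add: "s \<oplus>\<^bsub>star smash x\<^esub> t = (\<lambda>i\<in>obs <+> obs. code (val (s i) \<oplus>\<^bsub>M\<^esub> val (t i)))" for s t
    by (auto simp: star_def direct_sum_def fun_eq_iff restrict_def)
  have smult: "a \<odot>\<^bsub>star smash x\<^esub> s = (\<lambda>i\<in>obs <+> obs. code (a \<odot>\<^bsub>M\<^esub> val (s i)))" for a s
    by (auto simp: star_def direct_sum_def fun_eq_iff restrict_def)
  have linear: "?\<Phi> \<in> linear_maps R (star smash x) (star B ())"
  proof (rule linear_mapsI)
    fix s t assume s: "s \<in> carrier (star smash x)" and t: "t \<in> carrier (star smash x)"
    have st: "s \<oplus>\<^bsub>star smash x\<^esub> t \<in> carrier (star smash x)"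
      using s t x in_M[OF s] in_M[OF t] unfolding add carrier_star by (auto simp: component_closed)
    have "(\<Oplus>\<^bsub>M\<^esub>y\<in>obs. val ((s \<oplus>\<^bsub>star smash x\<^esub> t) (i y)))
        = (\<Oplus>\<^bsub>M\<^esub>y\<in>obs. val (s (i y))) \<oplus>\<^bsub>M\<^esub> (\<Oplus>\<^bsub>M\<^esub>y\<in>obs. val (t (i y)))" if "i = Inl \<or> i = Inr" for i
    proof -
      have "(\<Oplus>\<^bsub>M\<^esub>y\<in>obs. val ((s \<oplus>\<^bsub>star smash x\<^esub> t) (i y)))
          = (\<Oplus>\<^bsub>M\<^esub>y\<in>obs. val (s (i y)) \<oplus>\<^bsub>M\<^esub> val (t (i y)))"
        using that in_M[OF s] in_M[OF t] unfolding add by (intro M.finsum_cong') auto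
      also have "\<dots> = (\<Oplus>\<^bsub>M\<^esub>y\<in>obs. val (s (i y))) \<oplus>\<^bsub>M\<^esub> (\<Oplus>\<^bsub>M\<^esub>y\<in>obs. val (t (i y)))"
        using that in_M[OF s] in_M[OF t] by (intro M.finsum_addf) auto
      finally show ?thesis .
    qed
    from this[of Inl] this[of Inr]
    show "?\<Phi> (s \<oplus>\<^bsub>star smash x\<^esub> t) = ?\<Phi> s \<oplus>\<^bsub>star B ()\<^esub> ?\<Phi> t"
      unfolding star_map_eq[OF x s] star_map_eq[OF x t] star_map_eq[OF x st]
      by (auto simp: star_def direct_sum_def fun_eq_iff restrict_def split: sum.split)
  next
    fix a s assume a: "a \<in> carrier R" and s: "s \<in> carrier (star smash x)"
    have as: "a \<odot>\<^bsub>star smash x\<^esub> s \<in> carrier (star smash x)"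
      using s a x in_M[OF s] unfolding smult carrier_star by (auto simp: component_closed)
    have "(\<Oplus>\<^bsub>M\<^esub>y\<in>obs. val ((a \<odot>\<^bsub>star smash x\<^esub> s) (i y)))
        = a \<odot>\<^bsub>M\<^esub> (\<Oplus>\<^bsub>M\<^esub>y\<in>obs. val (s (i y)))" if "i = Inl \<or> i = Inr" for i
    proof -
      have "(\<Oplus>\<^bsub>M\<^esub>y\<in>obs. val ((a \<odot>\<^bsub>star smash x\<^esub> s) (i y)))
          = (\<Oplus>\<^bsub>M\<^esub>y\<in>obs. a \<odot>\<^bsub>M\<^esub> val (s (i y)))"
        using that in_M[OF s] a unfolding smult by (intro M.finsum_cong') auto
      also have "\<dots> = a \<odot>\<^bsub>M\<^esub> (\<Oplus>\<^bsub>M\<^esub>y\<in>obs. val (s (i y)))"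
        using that in_M[OF s] a finite_obs by (intro finsum_smult_ldistr[symmetric]) auto
      finally show ?thesis .
    qed
    from this[of Inl] this[of Inr]
    show "?\<Phi> (a \<odot>\<^bsub>star smash x\<^esub> s) = a \<odot>\<^bsub>star B ()\<^esub> ?\<Phi> s"
      unfolding star_map_eq[OF x s] star_map_eq[OF x as]
      by (auto simp: star_def direct_sum_def fun_eq_iff restrict_def split: sum.split)
  qed (rule closed)
  moreover have "inj_on ?\<Phi> (carrier (star smash x))"
  proof (rule inj_onI)
    fix s t assume s: "s \<in> carrier (star smash x)" and t: "t \<in> carrier (star smash x)"
      and eq: "?\<Phi> s = ?\<Phi> t"
    have l: "(\<Oplus>\<^bsub>M\<^esub>y\<in>obs. val (s (Inl y))) = (\<Oplus>\<^bsub>M\<^esub>y\<in>obs. val (t (Inl y)))"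
      and r: "(\<Oplus>\<^bsub>M\<^esub>y\<in>obs. val (s (Inr y))) = (\<Oplus>\<^bsub>M\<^esub>y\<in>obs. val (t (Inr y)))"
      using fun_cong[OF eq, of "Inl ()"] fun_cong[OF eq, of "Inr ()"]
      by (simp_all add: star_map_eq[OF x s] star_map_eq[OF x t] Plus_def)
    show "s = t"
    proof (rule extensionalityI[of _ "obs <+> obs"])
      fix i assume "i \<in> obs <+> obs"
      then show "s i = t i"
      proof (rule PlusE)
        fix y assume "y \<in> obs" "i = Inl y"
        then show ?thesis
          using s t reindexed_decomposition_unique[OF deg_bij(1)[OF x] _ _ l, of y]
          by (simp add: carrier_star)
      next
        fix y assume "y \<in> obs" "i = Inr y"
        then show ?thesis
          using s t reindexed_decomposition_unique[OF deg_bij(2)[OF x] _ _ r, of y]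
          by (simp add: carrier_star)
      qed
    qed (use s t in \<open>auto simp: carrier_star\<close>)
  qed
  moreover have "\<exists>s\<in>carrier (star smash x). ?\<Phi> s = w" if w: "w \<in> carrier (star B ())" for w
  proof -
    have "w (Inl ()) \<in> carrier M" "w (Inr ()) \<in> carrier M"
      using w unfolding carrier_star_one_object by (blast intro: PiE_mem InlI InrI)+
    from reindexed_decomposition_exists[OF deg_bij(1)[OF x] this(1)]
      reindexed_decomposition_exists[OF deg_bij(2)[OF x] this(2)]
    obtain p q where
      p: "\<forall>y\<in>obs. p y \<in> codes \<and> val (p y) \<in> component (deg x y)" "w (Inl ()) = (\<Oplus>\<^bsub>M\<^esub>y\<in>obs. val (p y))"
      and q: "\<forall>y\<in>obs. q y \<in> codes \<and> val (q y) \<in> component (deg y x)" "w (Inr ()) = (\<Oplus>\<^bsub>M\<^esub>y\<in>obs. val (q y))"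
      by blast
    let ?s = "\<lambda>i\<in>obs <+> obs. case_sum p q i"
    have s: "?s \<in> carrier (star smash x)"
      using p(1) q(1) by (auto simp: carrier_star)
    have l: "(\<Oplus>\<^bsub>M\<^esub>y\<in>obs. val (?s (Inl y))) = w (Inl ())"
      unfolding p(2) using p(1) by (intro M.finsum_cong') auto
    have r: "(\<Oplus>\<^bsub>M\<^esub>y\<in>obs. val (?s (Inr y))) = w (Inr ())"
      unfolding q(2) using q(1) by (intro M.finsum_cong') auto
    have "?\<Phi> ?s = w"
    proof (rule extensionalityI[of _ "{()} <+> {()}"])
      fix j :: "unit + unit" assume "j \<in> {()} <+> {()}"
      then show "?\<Phi> ?s j = w j"
        unfolding star_map_eq[OF x s] using l r by (cases j) auto
    qed (use w in \<open>auto simp: star_map_eq[OF x s] carrier_star_one_object PiE_def\<close>)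
    with s show ?thesis by blast
  qed
  ultimately show ?thesis
    using closed unfolding linear_isos_def bij_betw_def by auto
qed

lemma covering_degree_forget: "covering R smash B degree_forget"
proof -
  have "obs \<noteq> {}"
    using lab_bij G.one_closed by (auto simp: bij_betw_def)
  then show ?thesis
    using k_functor_degree_forget star_map_linear_iso by (auto simp: covering_def)
qed

text \<open>Left multiplication by \<open>g\<close> on objects, which preserves degrees because they have the form \<open>x\<inverse>y\<close>.
  These are the covering transformations, and they act transitively.\<close>

definition translation :: "'g \<Rightarrow> ('o, 'v, 'o, 'v) kfunctor" where
  "translation g = \<lparr>FObj = (\<lambda>x. inv_into obs lab (g \<otimes>\<^bsub>G\<^esub> lab x)), FMor = (\<lambda>x y f. f)\<rparr>"

lemma translation_obj:
  assumes "g \<in> carrier G" "x \<in> obs"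
  shows "FObj (translation g) x \<in> obs" "lab (FObj (translation g) x) = g \<otimes>\<^bsub>G\<^esub> lab x"
  using assms lab_bij
  by (auto simp: translation_def bij_betw_def inv_into_into f_inv_into_f)

lemma translation_mor [simp]: "FMor (translation g) x y = (\<lambda>f. f)"
  by (simp add: translation_def)

lemma deg_translation:
  assumes "g \<in> carrier G" "x \<in> obs" "y \<in> obs"
  shows "deg (FObj (translation g) x) (FObj (translation g) y) = deg x y"
proof -
  have "inv\<^bsub>G\<^esub> g \<otimes>\<^bsub>G\<^esub> (g \<otimes>\<^bsub>G\<^esub> lab y) = lab y"
    using assms by (simp add: G.m_assoc[symmetric])
  then show ?thesis
    using assms by (simp add: deg_def translation_obj G.inv_mult_group G.m_assoc)
qed

lemma k_functor_translation:
  assumes "g \<in> carrier G"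
  shows "k_functor R smash smash (translation g)"
  unfolding k_functor_def
  using k_category_smash assms
  by (simp add: Pi_def translation_obj deg_translation linear_maps_def)

lemma translation_inverse:
  assumes "g \<in> carrier G"
  shows "functor_eq smash (comp_functor (translation (inv\<^bsub>G\<^esub> g)) (translation g)) id_functor"
proof -
  have "FObj (translation (inv\<^bsub>G\<^esub> g)) (FObj (translation g) x) = x" if x: "x \<in> obs" for x
  proof -
    have "lab (FObj (translation (inv\<^bsub>G\<^esub> g)) (FObj (translation g) x)) = lab x"
      using assms x by (simp add: translation_obj G.m_assoc[symmetric])
    then show ?thesis
      using lab_bij x assms by (auto simp: bij_betw_def inj_on_def translation_obj)
  qed
  then show ?thesis
    by (simp add: functor_eq_def comp_functor_def id_functor_def)
qed

theorem galois_covering_degree_forget: "galois_covering R smash B degree_forget"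
proof -
  have "\<exists>G\<in>Aut1 R smash degree_forget. FObj G x = y" if xy: "x \<in> obs" "y \<in> obs" for x y
  proof -
    let ?g = "lab y \<otimes>\<^bsub>G\<^esub> inv\<^bsub>G\<^esub> lab x"
    have g: "?g \<in> carrier G" using xy by simp
    have "invertible_functor R smash smash (translation ?g)"
      unfolding invertible_functor_def
      using k_functor_translation[OF g] k_functor_translation[OF G.inv_closed[OF g]]
        translation_inverse[OF g] translation_inverse[OF G.inv_closed[OF g]] g
      by (intro conjI exI[of _ "translation (inv\<^bsub>G\<^esub> ?g)"]) (simp_all only: G.inv_inv)
    moreover have "functor_eq smash (comp_functor degree_forget (translation ?g)) degree_forget"
      by (auto simp: functor_eq_def comp_functor_def translation_def)
    moreover have "FObj (translation ?g) x = y"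
      using xy lab_bij by (simp add: translation_def G.m_assoc bij_betw_def inv_into_f_f)
    ultimately show ?thesis unfolding Aut1_def by blast
  qed
  then show ?thesis
    using covering_degree_forget connected_smash by (auto simp: galois_covering_def)
qed

end

section \<open>Gradings of the function algebra by characters\<close>

context perfect_pairing
begin

definition character_line :: "nat \<Rightarrow> (nat \<Rightarrow> 'x) \<Rightarrow> 'g \<Rightarrow> (nat \<Rightarrow> 'a) set" where
  "character_line n \<sigma> g = (\<lambda>a. \<lambda>i\<in>{..<n}. a \<otimes> \<beta> g (\<sigma> i)) ` carrier R"

text \<open>Existence and uniqueness of the decomposition into components are existence and uniqueness of the
  expansion in the characters \<open>\<beta> g\<close>, transported along \<open>\<sigma>\<close>. Degrees add up because \<open>\<beta>\<close> is multiplicative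
  in \<open>g\<close>.\<close>

lemma finite_grading_character_line:
  assumes \<sigma>: "bij_betw \<sigma> {..<n} (carrier Q)"
  shows "finite_grading R (power_algebra R n) G (character_line n \<sigma>)"
proof -
  let ?A = "power_algebra R n"
  interpret A: algebra R ?A by (rule algebra_power_algebra)
  have \<sigma>Q [simp]: "\<sigma> i \<in> carrier Q" if "i < n" for i
    using \<sigma> that by (auto simp: bij_betw_def)
  have b [simp]: "\<beta> g (\<sigma> i) \<in> carrier R" if "g \<in> carrier G" "i < n" for g i
    using that by (simp add: pair_in)
  have npos: "0 < n"
    using \<sigma> Q.one_closed by (auto simp: bij_betw_def)
  have sum: "finsum ?A (\<lambda>g. \<lambda>i\<in>{..<n}. c g \<otimes> \<beta> g (\<sigma> i)) (carrier G)
      = (\<lambda>i\<in>{..<n}. \<Oplus>g\<in>carrier G. c g \<otimes> \<beta> g (\<sigma> i))" if "c \<in> carrier G \<rightarrow> carrier R" for c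
  proof -
    have "finsum ?A (\<lambda>g. \<lambda>i\<in>{..<n}. c g \<otimes> \<beta> g (\<sigma> i)) (carrier G)
        = (\<lambda>i\<in>{..<n}. \<Oplus>g\<in>carrier G. (\<lambda>i\<in>{..<n}. c g \<otimes> \<beta> g (\<sigma> i)) i)"
      using finite_left that by (intro finsum_power_algebra) (auto simp: Pi_iff)
    also have "\<dots> = (\<lambda>i\<in>{..<n}. \<Oplus>g\<in>carrier G. c g \<otimes> \<beta> g (\<sigma> i))"
      by (intro restrict_ext) auto
    finally show ?thesis .
  qed
  show ?thesis
  proof (intro finite_grading.intro finite_grading_axioms.intro A.algebra_axioms field_axioms
      G.group_axioms finite_left)
    fix g assume g: "g \<in> carrier G"
    have minus: "\<ominus>\<^bsub>?A\<^esub> (\<lambda>i\<in>{..<n}. a \<otimes> \<beta> g (\<sigma> i)) = (\<lambda>i\<in>{..<n}. \<ominus> a \<otimes> \<beta> g (\<sigma> i))"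
      if "a \<in> carrier R" for a
      using g that by (intro A.M.minus_equality) (auto simp: l_distr[symmetric] l_neg cong: restrict_cong)
    show "submodule (character_line n \<sigma> g) R ?A"
    proof (rule A.submoduleI)
      show "character_line n \<sigma> g \<subseteq> carrier ?A"
        unfolding character_line_def using g by (auto intro!: restrict_PiE_iff[THEN iffD2])
      show "\<zero>\<^bsub>?A\<^esub> \<in> character_line n \<sigma> g"
        using g by (auto simp: character_line_def intro!: image_eqI[of _ _ \<zero>] restrict_ext)
    next
      fix v assume "v \<in> character_line n \<sigma> g"
      then show "\<ominus>\<^bsub>?A\<^esub> v \<in> character_line n \<sigma> g"
        using minus by (auto simp: character_line_def)
    next
      fix v w assume "v \<in> character_line n \<sigma> g" "w \<in> character_line n \<sigma> g"
      then obtain a b where "a \<in> carrier R" "b \<in> carrier R"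
        "v = (\<lambda>i\<in>{..<n}. a \<otimes> \<beta> g (\<sigma> i))" "w = (\<lambda>i\<in>{..<n}. b \<otimes> \<beta> g (\<sigma> i))"
        by (auto simp: character_line_def)
      then show "v \<oplus>\<^bsub>?A\<^esub> w \<in> character_line n \<sigma> g"
        using g by (auto simp: character_line_def l_distr intro!: image_eqI[of _ _ "a \<oplus> b"] restrict_ext)
    next
      fix c v assume c: "c \<in> carrier R" and "v \<in> character_line n \<sigma> g"
      then obtain a where "a \<in> carrier R" "v = (\<lambda>i\<in>{..<n}. a \<otimes> \<beta> g (\<sigma> i))"
        by (auto simp: character_line_def)
      then show "c \<odot>\<^bsub>?A\<^esub> v \<in> character_line n \<sigma> g"
        using g c by (auto simp: character_line_def m_assoc intro!: image_eqI[of _ _ "c \<otimes> a"] restrict_ext)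
    qed
    have "(\<lambda>i\<in>{..<n}. \<one> \<otimes> \<beta> g (\<sigma> i)) \<noteq> \<zero>\<^bsub>?A\<^esub>"
    proof
      assume "(\<lambda>i\<in>{..<n}. \<one> \<otimes> \<beta> g (\<sigma> i)) = \<zero>\<^bsub>?A\<^esub>"
      from fun_cong[OF this, of 0] show False
        using npos g pair_closed[of g "\<sigma> 0"] by simp
    qed
    then show "character_line n \<sigma> g \<noteq> {\<zero>\<^bsub>?A\<^esub>}"
      unfolding character_line_def by blast
  next
    fix g h v w assume gh: "g \<in> carrier G" "h \<in> carrier G"
      and "v \<in> character_line n \<sigma> g" "w \<in> character_line n \<sigma> h"
    then obtain a b where "a \<in> carrier R" "b \<in> carrier R"
      "v = (\<lambda>i\<in>{..<n}. a \<otimes> \<beta> g (\<sigma> i))" "w = (\<lambda>i\<in>{..<n}. b \<otimes> \<beta> h (\<sigma> i))"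
      by (auto simp: character_line_def)
    then show "v \<otimes>\<^bsub>?A\<^esub> w \<in> character_line n \<sigma> (g \<otimes>\<^bsub>G\<^esub> h)"
      using gh by (auto simp: character_line_def pair_mult_left m_ac
          intro!: image_eqI[of _ _ "a \<otimes> b"] restrict_ext)
  next
    show "\<one>\<^bsub>?A\<^esub> \<in> character_line n \<sigma> \<one>\<^bsub>G\<^esub>"
      by (auto simp: character_line_def pair_one intro!: image_eqI[of _ _ \<one>] restrict_ext)
  next
    fix f assume f: "f \<in> carrier ?A"
    let ?\<tau> = "inv_into {..<n} \<sigma>"
    have "?\<tau> x < n" if "x \<in> carrier Q" for x
      using that \<sigma> inv_into_into[of x \<sigma> "{..<n}"] by (simp add: bij_betw_def)
    then have "(\<lambda>x. f (?\<tau> x)) \<in> carrier Q \<rightarrow> carrier R" using f by auto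
    then obtain c where c: "c \<in> carrier G \<rightarrow> carrier R"
      "\<And>x. x \<in> carrier Q \<Longrightarrow> f (?\<tau> x) = (\<Oplus>g\<in>carrier G. c g \<otimes> \<beta> g x)"
      by (rule expansion_exists) blast
    have "f i = (\<Oplus>g\<in>carrier G. c g \<otimes> \<beta> g (\<sigma> i))" if "i < n" for i
      using c(2)[of "\<sigma> i"] that \<sigma> by (simp add: bij_betw_def inv_into_f_f)
    then have "f = (\<lambda>i\<in>{..<n}. \<Oplus>g\<in>carrier G. c g \<otimes> \<beta> g (\<sigma> i))"
      using f by (intro extensionalityI[of _ "{..<n}"]) (auto simp: PiE_def)
    then show "\<exists>s. (\<forall>g\<in>carrier G. s g \<in> character_line n \<sigma> g) \<and> f = finsum ?A s (carrier G)"
      using c(1) by (intro exI[of _ "\<lambda>g. \<lambda>i\<in>{..<n}. c g \<otimes> \<beta> g (\<sigma> i)"])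
        (auto simp: sum character_line_def)
  next
    fix s t g
    assume s: "\<forall>g\<in>carrier G. s g \<in> character_line n \<sigma> g"
      and t: "\<forall>g\<in>carrier G. t g \<in> character_line n \<sigma> g"
      and eq: "finsum ?A s (carrier G) = finsum ?A t (carrier G)" and g: "g \<in> carrier G"
    have coeff: "\<exists>c \<in> carrier G \<rightarrow> carrier R. (\<forall>g\<in>carrier G. r g = (\<lambda>i\<in>{..<n}. c g \<otimes> \<beta> g (\<sigma> i))) \<and>
        finsum ?A r (carrier G) = (\<lambda>i\<in>{..<n}. \<Oplus>g\<in>carrier G. c g \<otimes> \<beta> g (\<sigma> i))"
      if r: "\<forall>g\<in>carrier G. r g \<in> character_line n \<sigma> g" for r
    proof -
      from r have "\<forall>g\<in>carrier G. \<exists>a. a \<in> carrier R \<and> r g = (\<lambda>i\<in>{..<n}. a \<otimes> \<beta> g (\<sigma> i))"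
        by (auto simp: character_line_def)
      then obtain c where c: "\<forall>g\<in>carrier G. c g \<in> carrier R \<and> r g = (\<lambda>i\<in>{..<n}. c g \<otimes> \<beta> g (\<sigma> i))"
        by metis
      have "finsum ?A r (carrier G) = finsum ?A (\<lambda>g. \<lambda>i\<in>{..<n}. c g \<otimes> \<beta> g (\<sigma> i)) (carrier G)"
        using c by (intro A.M.finsum_cong') auto
      then show ?thesis
        using c sum[of c] by (intro bexI[of _ c]) auto
    qed
    obtain c where c: "c \<in> carrier G \<rightarrow> carrier R" "\<forall>g\<in>carrier G. s g = (\<lambda>i\<in>{..<n}. c g \<otimes> \<beta> g (\<sigma> i))"
      "finsum ?A s (carrier G) = (\<lambda>i\<in>{..<n}. \<Oplus>g\<in>carrier G. c g \<otimes> \<beta> g (\<sigma> i))"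
      using coeff[OF s] by blast
    obtain c' where c': "c' \<in> carrier G \<rightarrow> carrier R" "\<forall>g\<in>carrier G. t g = (\<lambda>i\<in>{..<n}. c' g \<otimes> \<beta> g (\<sigma> i))"
      "finsum ?A t (carrier G) = (\<lambda>i\<in>{..<n}. \<Oplus>g\<in>carrier G. c' g \<otimes> \<beta> g (\<sigma> i))"
      using coeff[OF t] by blast
    have "c g = c' g"
    proof (rule expansion_unique[OF c(1) c'(1) _ g])
      fix x assume "x \<in> carrier Q"
      then obtain i where i: "i < n" "x = \<sigma> i" using \<sigma> by (auto simp: bij_betw_def)
      show "(\<Oplus>h\<in>carrier G. c h \<otimes> \<beta> h x) = (\<Oplus>h\<in>carrier G. c' h \<otimes> \<beta> h x)"
        using fun_cong[OF eq, of i] i by (simp add: c(3) c'(3))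
    qed
    then show "s g = t g" using c(2) c'(2) g by simp
  qed
qed

end

text \<open>The covering belongs to the grading by \<open>\<mu>\<^sub>d \<times> \<mu>\<^sub>m\<close>. Writing an index as \<open>i = i mod d + d * (i div d)\<close>
  identifies \<open>{..<d * m}\<close> with \<open>\<int>/d \<times> \<int>/m\<close>. What the rest of the proof needs of the covering is the
  shape of the images of its morphisms, that is, of the homogeneous elements.\<close>

lemma galois_covering_by_roots_of_unity:
  fixes K :: "('k, 'r) ring_scheme" (structure) and d m :: nat
  assumes "field K" and d: "0 < d" and m: "0 < m"
    and roots: "card {x \<in> carrier K. x [^] (d * m) = \<one>} = d * m"
    and inf: "infinite (UNIV :: 'c set)"
    and inj: "inj_on (\<iota> :: (nat \<Rightarrow> 'k) \<Rightarrow> 'd) (carrier (power_algebra K (d * m)))"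
  obtains C :: "('k, 'c, 'd) kcategory" and F :: "('c, 'd, unit, nat \<Rightarrow> 'k) kfunctor"
  where "galois_covering K C (one_object_category (power_algebra K (d * m))) F"
    and "\<And>x y f. \<lbrakk>x \<in> Obj C; y \<in> Obj C; f \<in> carrier (Mor C x y)\<rbrakk> \<Longrightarrow>
      \<exists>a \<xi> \<eta>. a \<in> carrier K \<and> \<xi> \<in> carrier K \<and> \<xi> [^] d = \<one> \<and> \<eta> \<in> carrier K \<and> \<eta> [^] m = \<one> \<and>
        FMor F x y f = (\<lambda>i\<in>{..<d * m}. a \<otimes> (\<xi> [^] (i mod d) \<otimes> \<eta> [^] (i div d)))"
proof -
  interpret K: field K by fact
  let ?G = "roots_of_unity K d \<times>\<times> roots_of_unity K m"
  let ?Q = "integer_mod_group d \<times>\<times> integer_mod_group m"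
  let ?A = "power_algebra K (d * m)"
  interpret P: perfect_pairing K ?G ?Q K.unity_pairing
    by (rule K.perfect_pairing_roots_of_unity[OF d m roots])
  define \<sigma> where "\<sigma> i = (int (i mod d), int (i div d))" for i
  have \<sigma>: "bij_betw \<sigma> {..<d * m} (carrier ?Q)"
  proof (rule bij_betw_byWitness[where f' = "\<lambda>(a, b). nat a + d * nat b"])
    show "\<forall>i\<in>{..<d * m}. (\<lambda>(a, b). nat a + d * nat b) (\<sigma> i) = i"
      by (simp add: \<sigma>_def)
    show "\<forall>x\<in>carrier ?Q. \<sigma> ((\<lambda>(a, b). nat a + d * nat b) x) = x"
      using d m by (auto simp: \<sigma>_def carrier_integer_mod_group nat_less_iff)
    show "\<sigma> ` {..<d * m} \<subseteq> carrier ?Q"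
      using d m by (auto simp: \<sigma>_def carrier_integer_mod_group less_mult_imp_div_less mult.commute)
    have "a + d * b < d * m" if "a < d" "b < m" for a b
    proof -
      have "a + d * b < d * Suc b" using that by simp
      also have "\<dots> \<le> d * m" using that by (intro mult_le_mono2) simp
      finally show ?thesis .
    qed
    then show "(\<lambda>(a, b). nat a + d * nat b) ` carrier ?Q \<subseteq> {..<d * m}"
      using d m by (auto simp: carrier_integer_mod_group nat_less_iff)
  qed
  interpret grading: finite_grading K ?A ?G "P.character_line (d * m) \<sigma>"
    by (rule P.finite_grading_character_line[OF \<sigma>])
  obtain obs :: "'c set" where "finite obs" "card obs = card (carrier ?G)"
    using infinite_arbitrarily_large[OF inf, of "card (carrier ?G)"] by blast
  then obtain lab where lab: "bij_betw lab obs (carrier ?G)"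
    using finite_same_card_bij[OF _ P.finite_left] by blast
  have val: "bij_betw (inv_into (carrier ?A) \<iota>) (\<iota> ` carrier ?A) (carrier ?A)"
    using inj by (intro bij_betw_inv_into inj_on_imp_bij_betw)
  interpret S: smash_product K ?A ?G "P.character_line (d * m) \<sigma>" obs lab
      "\<iota> ` carrier ?A" "inv_into (carrier ?A) \<iota>"
    using lab val by unfold_locales
  show thesis
  proof (rule that[OF S.galois_covering_degree_forget])
    fix x y f assume "x \<in> Obj S.smash" "y \<in> Obj S.smash" "f \<in> carrier (Mor S.smash x y)"
    then have "x \<in> obs" "y \<in> obs"
      and "inv_into (carrier ?A) \<iota> f \<in> P.character_line (d * m) \<sigma> (S.deg x y)"
      unfolding S.smash_simps by blast+
    moreover from this have g: "S.deg x y \<in> carrier ?G" by (intro S.deg_in)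
    ultimately
    obtain a where a: "a \<in> carrier K"
      "inv_into (carrier ?A) \<iota> f = (\<lambda>i\<in>{..<d * m}. a \<otimes> K.unity_pairing (S.deg x y) (\<sigma> i))"
      unfolding P.character_line_def by blast
    obtain \<xi> \<eta> where \<xi>: "S.deg x y = (\<xi>, \<eta>)" by (cases "S.deg x y")
    show "\<exists>a \<xi> \<eta>. a \<in> carrier K \<and> \<xi> \<in> carrier K \<and> \<xi> [^] d = \<one> \<and> \<eta> \<in> carrier K \<and> \<eta> [^] m = \<one> \<and>
        FMor S.degree_forget x y f = (\<lambda>i\<in>{..<d * m}. a \<otimes> (\<xi> [^] (i mod d) \<otimes> \<eta> [^] (i div d)))"
      unfolding S.degree_forget_simps a(2) using a(1) g
      by (intro exI[of _ a] exI[of _ \<xi>] exI[of _ \<eta>]) (simp add: \<xi> K.unity_pairing_def \<sigma>_def)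
  qed
qed

section \<open>Universal coverings\<close>

lemma k_functor_closed:
  assumes "k_functor K C D F"
  shows "x \<in> Obj C \<Longrightarrow> FObj F x \<in> Obj D"
    and "\<lbrakk>x \<in> Obj C; y \<in> Obj C; f \<in> carrier (Mor C x y)\<rbrakk> \<Longrightarrow>
      FMor F x y f \<in> carrier (Mor D (FObj F x) (FObj F y))"
  using assms unfolding k_functor_def linear_maps_def by blast+

text \<open>The universal property provides a functor \<open>H\<close> from \<open>\<U>\<close> to \<open>C\<close> with \<open>F H = P\<close>; as base point in \<open>C\<close> one
  takes any object of the fibre over the image of \<open>u\<close>. The morphism \<open>h\<close> is the image of \<open>f\<close> under \<open>H\<close>.\<close>

lemma universal_covering_factors:
  fixes C :: "('k, 'c, 'd) kcategory"
  assumes U: "universal_covering TYPE('c \<times> 'd) K \<U> B P" and F: "galois_covering K C B F"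
    and u: "u \<in> Obj \<U>" and v: "v \<in> Obj \<U>" and f: "f \<in> carrier (Mor \<U> u v)"
  obtains x y h where "x \<in> Obj C" "y \<in> Obj C" "h \<in> carrier (Mor C x y)" "FMor P u v f = FMor F x y h"
proof -
  have "k_functor K \<U> B P" "FObj F ` Obj C = Obj B"
    using U F by (simp_all add: universal_covering_def galois_covering_def covering_def)
  then have "FObj P u \<in> FObj F ` Obj C"
    using u by (simp add: k_functor_closed)
  then obtain c where c: "c \<in> Obj C" "FObj P u = FObj F c"
    by blast
  obtain H where H: "covering_morphism K B \<U> P C F H id_functor"
    using U F u c unfolding universal_covering_def by blast
  then have "k_functor K \<U> C H" and eq: "functor_eq \<U> (comp_functor F H) (comp_functor id_functor P)"
    by (simp_all add: covering_morphism_def)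
  then have "FObj H u \<in> Obj C" "FObj H v \<in> Obj C"
    "FMor H u v f \<in> carrier (Mor C (FObj H u) (FObj H v))"
    using u v f by (simp_all add: k_functor_closed)
  moreover have "FMor P u v f = FMor F (FObj H u) (FObj H v) (FMor H u v f)"
    using eq u v f by (simp add: functor_eq_def comp_functor_def id_functor_def)
  ultimately show thesis by (rule that)
qed

text \<open>This uses the surjectivity of the star map on the outgoing half of the star: the element \<open>a\<close> is
  completed by zero on the incoming half.\<close>

lemma covering_star_spans:
  assumes A: "abelian_monoid A" and P: "covering K \<U> (one_object_category A) P"
    and u: "u \<in> Obj \<U>" and a: "a \<in> carrier A"
  obtains I s where "finite I" "I \<subseteq> Obj \<U>" "\<And>v. v \<in> I \<Longrightarrow> s v \<in> carrier (Mor \<U> u v)"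
    "\<And>v. v \<in> I \<Longrightarrow> FMor P u v (s v) \<in> carrier A" "a = (\<Oplus>\<^bsub>A\<^esub>v\<in>I. FMor P u v (s v))"
proof -
  interpret A: abelian_monoid A by fact
  let ?B = "one_object_category A"
  define w where "w = (\<lambda>j\<in>{()} <+> {()}. if j = Inl () then a else \<zero>\<^bsub>A\<^esub>)"
  have "w \<in> carrier (star ?B ())"
    using a by (auto simp: w_def star_def direct_sum_def)
  moreover have "bij_betw (star_map \<U> ?B P u) (carrier (star \<U> u)) (carrier (star ?B ()))"
    using P u by (auto simp: covering_def linear_isos_def)
  ultimately obtain s where s: "s \<in> carrier (star \<U> u)" "star_map \<U> ?B P u s = w"
    unfolding bij_betw_def by (metis imageE)
  define I where "I = {v \<in> Obj \<U>. s (Inl v) \<noteq> \<zero>\<^bsub>Mor \<U> u v\<^esub>}"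
  have mor: "s (Inl v) \<in> carrier (Mor \<U> u v)" if "v \<in> I" for v
    using s(1) that PiE_mem[of s _ _ "Inl v"] by (force simp: star_def direct_sum_def I_def)
  have img: "FMor P u v (s (Inl v)) \<in> carrier A" if "v \<in> I" for v
  proof -
    have "k_functor K \<U> ?B P" "v \<in> Obj \<U>"
      using P that by (simp_all only: covering_def I_def mem_Collect_eq)
    from k_functor_closed(2)[OF this(1) u this(2) mor[OF that]] show ?thesis by simp
  qed
  have "finite {i \<in> Obj \<U> <+> Obj \<U>. s i \<noteq> \<zero>\<^bsub>star_space \<U> u i\<^esub>}"
    using s(1) by (simp add: star_def direct_sum_def)
  moreover have "Inl ` I \<subseteq> {i \<in> Obj \<U> <+> Obj \<U>. s i \<noteq> \<zero>\<^bsub>star_space \<U> u i\<^esub>}"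
    by (auto simp: I_def)
  ultimately have fin: "finite I" by (meson finite_imageD finite_subset inj_Inl)
  have index: "{i \<in> Obj \<U> <+> Obj \<U>. map_sum (FObj P) (FObj P) i = Inl () \<and>
      s i \<noteq> \<zero>\<^bsub>star_space \<U> u i\<^esub>} = Inl ` I"
    by (auto simp: I_def)
  have "a = star_map \<U> ?B P u s (Inl ())"
    by (simp add: s(2) w_def Plus_def)
  also have "\<dots> = (\<Oplus>\<^bsub>A\<^esub>i\<in>Inl ` I. star_functor P u i (s i))"
    by (simp add: star_map_def index[symmetric] Plus_def)
  also have "\<dots> = (\<Oplus>\<^bsub>A\<^esub>v\<in>I. FMor P u v (s (Inl v)))"
    using img by (subst A.finsum_reindex) auto
  finally show thesis
    using fin mor img by (intro that[of I "\<lambda>v. s (Inl v)"]) (auto simp: I_def)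
qed

theorem corollary6p2:
  fixes K :: "('k, 'r) ring_scheme" (structure) and n :: nat
  assumes "field K"
    and "n > 0"
    and "\<not> squarefree n"
    and "\<exists>S \<subseteq> {\<zeta> \<in> carrier K. \<zeta> [^] n = \<one>}. card S = n"
    \<comment> \<open>the universe of the universal property contains a countable set and the algebra itself\<close>
    and "infinite (UNIV :: 'c set)"
    and "\<exists>\<iota> :: (nat \<Rightarrow> 'k) \<Rightarrow> 'd. inj_on \<iota> (carrier (power_algebra K n))"
  shows "\<nexists>(\<U> :: ('k, 'u, 'x) kcategory) U.
           universal_covering TYPE('c \<times> 'd) K \<U> (one_object_category (power_algebra K n)) U"
proof (intro notI, elim exE)
  fix \<U> :: "('k, 'u, 'x) kcategory" and P
  let ?A = "power_algebra K n"
  let ?B = "one_object_category ?A"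
  assume U: "universal_covering TYPE('c \<times> 'd) K \<U> ?B P"
  interpret K: field K by fact
  interpret A: algebra K ?A by (rule K.algebra_power_algebra)
  obtain p where p: "p\<^sup>2 dvd n" "p \<noteq> 1"
    using assms(3) by (auto simp: squarefree_def)
  then obtain r where "n = p\<^sup>2 * r" by blast
  then have r: "n = p * (p * r)" by (simp add: power2_eq_square)
  define m where "m = p * r"
  have n: "n = p * m" "0 < p" "0 < m" "m < n" "1 < n"
  proof -
    show n: "n = p * m" by (simp add: r m_def)
    show "0 < p" "0 < m" using n \<open>n > 0\<close> by (auto intro: Nat.gr0I)
    then have "1 < p" using p(2) by simp
    then show "m < n" using n \<open>0 < m\<close> by simp
    then show "1 < n" using \<open>0 < m\<close> by simp
  qed
  have card_n: "card {x \<in> carrier K. x [^] n = \<one>} = n"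
    using assms(4) K.card_roots_of_unity_le[OF \<open>n > 0\<close>] by (metis card_mono le_antisym)
  obtain \<iota> :: "(nat \<Rightarrow> 'k) \<Rightarrow> 'd" where \<iota>: "inj_on \<iota> (carrier ?A)"
    using assms(6) by blast
  obtain C1 :: "('k, 'c, 'd) kcategory" and F1 where F1: "galois_covering K C1 ?B F1"
    "\<And>x y f. \<lbrakk>x \<in> Obj C1; y \<in> Obj C1; f \<in> carrier (Mor C1 x y)\<rbrakk> \<Longrightarrow>
      \<exists>a \<xi> \<eta>. a \<in> carrier K \<and> \<xi> \<in> carrier K \<and> \<xi> [^] (1 :: nat) = \<one> \<and> \<eta> \<in> carrier K \<and> \<eta> [^] n = \<one> \<and>
        FMor F1 x y f = (\<lambda>i\<in>{..<n}. a \<otimes> (\<xi> [^] (i mod 1) \<otimes> \<eta> [^] (i div 1)))"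
    using galois_covering_by_roots_of_unity[of K 1 n \<iota>] assms(1,2,5) card_n \<iota>
    by (simp only: mult_1 zero_less_one) blast
  obtain C2 :: "('k, 'c, 'd) kcategory" and F2 where F2: "galois_covering K C2 ?B F2"
    "\<And>x y f. \<lbrakk>x \<in> Obj C2; y \<in> Obj C2; f \<in> carrier (Mor C2 x y)\<rbrakk> \<Longrightarrow>
      \<exists>a \<xi> \<eta>. a \<in> carrier K \<and> \<xi> \<in> carrier K \<and> \<xi> [^] p = \<one> \<and> \<eta> \<in> carrier K \<and> \<eta> [^] m = \<one> \<and>
        FMor F2 x y f = (\<lambda>i\<in>{..<n}. a \<otimes> (\<xi> [^] (i mod p) \<otimes> \<eta> [^] (i div p)))"
    using galois_covering_by_roots_of_unity[of K p m \<iota>] assms(1,5) n(2,3) card_n \<iota>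
    unfolding n(1)[symmetric] by blast
  \<comment> \<open>The images under \<open>P\<close> are homogeneous for \<open>\<mu>\<^sub>n\<close> and for \<open>\<mu>\<^sub>p \<times> \<mu>\<^sub>m\<close>.\<close>
  have agree: "FMor P u v f 0 = FMor P u v f m"
    if uvf: "u \<in> Obj \<U>" "v \<in> Obj \<U>" "f \<in> carrier (Mor \<U> u v)" for u v f
  proof -
    obtain x y h where h: "x \<in> Obj C1" "y \<in> Obj C1" "h \<in> carrier (Mor C1 x y)"
      "FMor P u v f = FMor F1 x y h"
      by (rule universal_covering_factors[OF U F1(1) uvf])
    from F1(2)[OF h(1-3)] obtain a \<xi> \<zeta> where a: "a \<in> carrier K" "\<zeta> \<in> carrier K" "\<xi> [^] (1 :: nat) = \<one>" "\<xi> \<in> carrier K"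
      "FMor P u v f = (\<lambda>i\<in>{..<n}. a \<otimes> (\<xi> [^] (i mod 1) \<otimes> \<zeta> [^] (i div 1)))"
      unfolding h(4)[symmetric] by blast
    have v1: "FMor P u v f i = a \<otimes> \<zeta> [^] i" if "i < n" for i
      using a that by simp
    obtain x y h where h: "x \<in> Obj C2" "y \<in> Obj C2" "h \<in> carrier (Mor C2 x y)"
      "FMor P u v f = FMor F2 x y h"
      by (rule universal_covering_factors[OF U F2(1) uvf])
    from F2(2)[OF h(1-3)] obtain b \<xi> \<eta> where b: "b \<in> carrier K" "\<xi> \<in> carrier K" "\<xi> [^] p = \<one>"
      "\<eta> \<in> carrier K" "\<eta> [^] m = \<one>"
      "FMor P u v f = (\<lambda>i\<in>{..<n}. b \<otimes> (\<xi> [^] (i mod p) \<otimes> \<eta> [^] (i div p)))"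
      unfolding h(4)[symmetric] by blast
    have pow_m: "(z [^] k) [^] m = \<one>" if "z \<in> carrier K" "z [^] m = \<one>" for z and k :: nat
      using K.nat_pow_pow[of z k m] K.nat_pow_pow[of z m k] that
      by (simp add: mult.commute)
    \<comment> \<open>Here \<open>p\<^sup>2\<close> dividing \<open>n\<close> enters: \<open>p\<close> divides \<open>m\<close>, so \<open>m\<close> is an exponent of \<open>\<mu>\<^sub>p \<times> \<mu>\<^sub>m\<close>.\<close>
    have "\<xi> [^] m = (\<xi> [^] p) [^] r"
      using b(2) by (simp only: m_def K.nat_pow_pow)
    then have "\<xi> [^] m = \<one>" using b(3) by simp
    then have "(FMor P u v f i) [^] m = b [^] m" if "i < n" for i
      using b that by (simp add: K.nat_pow_distrib pow_m)
    from this[of 0] this[of 1] have "(a \<otimes> \<zeta> [^] (0 :: nat)) [^] m = (a \<otimes> \<zeta> [^] (1 :: nat)) [^] m"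
      using n v1 by simp
    then have eq: "a [^] m \<otimes> \<one> = a [^] m \<otimes> \<zeta> [^] m"
      using a by (simp add: K.nat_pow_distrib)
    show ?thesis
    proof (cases "a = \<zero>")
      case True
      then show ?thesis using v1 n a by simp
    next
      case False
      then have "a [^] m \<in> Units K"
        using a(1) by (intro K.Units_pow_closed) (simp add: K.field_Units)
      then have "a [^] m \<noteq> \<zero>" by (simp add: K.field_Units)
      then have "\<zeta> [^] m = \<one>"
        using eq a K.m_lcancel[of "a [^] m" \<one> "\<zeta> [^] m"] by simp
      then show ?thesis using v1 n a by simp
    qed
  qed
  have P: "covering K \<U> ?B P"
    using U by (simp add: universal_covering_def galois_covering_def)
  then have "FObj P ` Obj \<U> = Obj ?B" unfolding covering_def by blast
  then obtain u where u: "u \<in> Obj \<U>"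
    by (metis ex_in_conv image_empty insert_not_empty one_object_category_simps(1))
  \<comment> \<open>The indicator function of \<open>0\<close> separates \<open>0\<close> from \<open>m\<close>, so it is not a sum of such images.\<close>
  define e where "e = (\<lambda>i\<in>{..<n}. if i = 0 then \<one> else \<zero>)"
  have "e \<in> carrier ?A" by (simp add: e_def)
  then obtain I s where I: "finite I" "I \<subseteq> Obj \<U>" "\<And>v. v \<in> I \<Longrightarrow> s v \<in> carrier (Mor \<U> u v)"
    "\<And>v. v \<in> I \<Longrightarrow> FMor P u v (s v) \<in> carrier ?A" "e = (\<Oplus>\<^bsub>?A\<^esub>v\<in>I. FMor P u v (s v))"
    by (rule covering_star_spans[OF A.abelian_monoid_axioms P u]) blast
  have e_eq: "e = (\<lambda>i\<in>{..<n}. \<Oplus>v\<in>I. FMor P u v (s v) i)"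
    using I K.finsum_power_algebra[OF I(1)] by (simp add: Pi_def)
  have entries: "FMor P u v (s v) i \<in> carrier K" if "v \<in> I" "i < n" for v i
    using I(4)[OF that(1)] that(2) by auto
  have "e 0 = e m"
    unfolding e_eq using n u I entries
    by (simp, intro K.finsum_cong') (auto intro!: agree)
  then show False
    using n by (simp add: e_def)
qed

end
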